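(* Let $\mathbf{u}\in\mathcal{P}'$ be a regular functional and let $\{P_n\}_{n\ge 0}$ be its monic orthogonal polynomial sequence (monic OP), with the convention $P_{-1}=0$. Then the following properties are equivalent. (C1) There are nonzero polynomials $\phi\in\mathcal{P}_2$ and $\psi\in\mathcal{P}_1$ such that $D(\phi\mathbf{u})=\psi\mathbf{u}$ (i.e. $\mathbf{u}$ is classical). (C1$'$) There is an admissible pair $(\phi,\psi)$ such that $D(\phi\mathbf{u})=\psi\mathbf{u}$. (C2) There exist a polynomial $\phi\in\mathcal{P}_2$ and, for each $n\in\mathbb{N}_0$, complex parameters $a_n,b_n,c_n$, with $c_n\ne 0$ if $n\ge 1$, such that $$\phi(x)P_n'(x)=a_nP_{n+1}(x)+b_nP_n(x)+c_nP_{n-1}(x),\quad n\ge 0.$$ (C3) $\{P_n^{[k]}\}_{n\ge 0}$ is a monic OP for some $k\in\mathbb{N}$. (C3$'$) $\{P_n^{[k]}\}_{n\ge 0}$ is a monic OP for each $k\in\mathbb{N}$. (C4) There exist $k\in\mathbb{N}$ and complex parameters $r_n^{[k]}$ and $s_n^{[k]}$ such that $$P_n^{[k-1]}(x)=P_n^{[k]}(x)+r_n^{[k]}P_{n-1}^{[k]}(x)+s_n^{[k]}P_{n-2}^{[k]}(x),\quad n\ge 2.$$ (C4$'$) For each $k\in\mathbb{N}$ there exist complex parameters $r_n^{[k]}$ and $s_n^{[k]}$ such that $P_n^{[k-1]}(x)=P_n^{[k]}(x)+r_n^{[k]}P_{n-1}^{[k]}(x)+s_n^{[k]}P_{n-2}^{[k]}(x)$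 holds for all $n\ge 2$. (C5) There exist polynomials $\phi$ and $\psi$ and, for each $n\ge 0$, a complex parameter $\lambda_n$, with $\lambda_n\ne 0$ if $n\ge 1$, such that $y=P_n(x)$ is a solution of $$\phi(x)y''+\psi(x)y'+\lambda_n y=0,\quad n\ge 0.$$ (C6) There is an admissible pair $(\phi,\psi)$ such that the formal Stieltjes series $S_{\mathbf{u}}(z)=-\sum_{n=0}^{\infty}u_n/z^{n+1}$ satisfies (formally) $$\phi(z)S_{\mathbf{u}}'(z)=[\psi(z)-\phi'(z)]S_{\mathbf{u}}(z)+\left(\psi'-\tfrac12\phi''\right)u_0.$$ (C7) There exist an admissible pair $(\phi,\psi)$ and, for each $n\ge 1$, complex parameters $h_n$ and $t_n$ such that $$\phi\,(P_nP_{n-1})'=h_nP_n^2-(\psi-\phi')P_nP_{n-1}+t_nP_{n-1}^2 .$$ (C8) There exist a polynomial $\phi\in\mathcal{P}_2$ and nonzero complex parameters $k_n$ such that $$P_n\mathbf{u}=k_nD^n(\phi^n\mathbf{u}),\quad n\ge 0.$$ Moreover, the polynomials $\phi$ and $\psi$ may be taken the same in all of the properties (C1), (C1$'$), (C2), (C5), (C6), (C7), (C8) (where $\psi$ does not appear in (C2) and (C8)). In addition, let the three-term recurrence relation satisfied by $\{P_n\}_{n\ge 0}$ be $$P_{n+1}(x)=(x-\beta_n)P_n(x)-\gamma_nP_{n-1}(x),\quad n\ge 0,\qquad P_{-1}=0,\ P_0=1,$$ and write $\phi(x)=ax^2+bx+c$, $\psi(x)=px+q$, $d_n=na+p$, $e_n=nb+q$.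 Then $$\beta_n=-\frac{d_{-2}\,q+2bn\,d_{n-1}}{d_{2n}d_{2n-2}}\ (n\ge 0),\qquad \gamma_n=-\frac{n\,d_{n-2}}{d_{2n-3}d_{2n-1}}\,\phi\!\left(-\frac{e_{n-1}}{d_{2n-2}}\right)\ (n\ge 1),$$ where for $n=0$ the common factor $d_{-2}$ in $\beta_0$ is cancelled, so $\beta_0=-q/p$, and for $n=1$ the common factor $d_{-1}$ in $\gamma_1$ is cancelled, so $\gamma_1=-\phi(-q/p)/d_1$; and, with this common pair $(\phi,\psi)$, the parameters $a_n,b_n,c_n$ in (C2), $r_n^{[1]},s_n^{[1]}$ in (C4$'$) for $k=1$, $\lambda_n$ in (C5), $h_n,t_n$ in (C7) and $k_n$ in (C8) are given by $$a_n=na,\quad b_n=-\tfrac12\psi(\beta_n)\quad(n\ge 0),\qquad c_n=-d_{n-1}\gamma_n\quad (n\ge 1),$$ $$r_n^{[1]}=\frac{\psi(\beta_n)}{2d_{n-1}},\qquad s_n^{[1]}=-\frac{(n-1)a}{d_{n-2}}\gamma_n\quad (n\ge 2),$$ $$\lambda_n=-nd_{n-1}\quad(n\ge 0),\qquad h_n=d_{2n-3},\quad t_n=-d_{2n-1}\gamma_n\quad(n\ge 1),\qquad k_n=\prod_{i=0}^{n-1}d_{n+i-1}^{-1}\quad(n\ge 0).$$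
   Context: $\mathcal{P}=\mathbb{C}[x]$ is the space of polynomials with complex coefficients, $\mathcal{P}_n$ the subspace of polynomials of degree at most $n$, and $\mathcal{P}'$ the space of all linear functionals $\mathbf{u}:\mathcal{P}\to\mathbb{C}$ (with the topology used, every linear functional is continuous, so this is the full algebraic dual). The action of $\mathbf{u}$ on $p$ is $\langle\mathbf{u},p\rangle$ and $u_n=\langle\mathbf{u},x^n\rangle$ are the moments. $\mathbb{N}=\{1,2,\dots\}$, $\mathbb{N}_0=\mathbb{N}\cup\{0\}$. For $\mathbf{u}\in\mathcal{P}'$ and $\phi\in\mathcal{P}$, the functionals $\phi\mathbf{u}$ and $D\mathbf{u}$ are defined by $\langle\phi\mathbf{u},p\rangle=\langle\mathbf{u},\phi p\rangle$ and $\langle D\mathbf{u},p\rangle=-\langle\mathbf{u},p'\rangle$ for $p\in\mathcal{P}$; $D^n$ is the $n$-th iterate of $D$. A sequence $\{P_n\}_{n\ge0}$ of polynomials with $\deg P_n=n$ is an orthogonal polynomial sequence (OP) with respect to $\mathbf{u}$ if $\langle\mathbf{u},P_mP_n\rangle=\kappa_n\delta_{m,n}$ for all $m,n\ge 0$, with $\kappa_n\in\mathbb{C}\setminus\{0\}$; it is a monic OP if every $P_n$ is monic. "Is a monic OP" with no functional mentioned means: with respect to some functional in $\mathcal{P}'$. $\mathbf{u}$ is regular if there exists an OP with respect to $\mathbf{u}$ (its monic OP is then unique). For $k,n\in\mathbb{N}_0$, $P_n^{[k]}(x)=\dfrac{1}{(n+1)_k}\dfrac{d^k}{dx^k}P_{n+k}(x)$,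 where $(\alpha)_0=1$, $(\alpha)_k=\alpha(\alpha+1)\cdots(\alpha+k-1)$; thus $P_n^{[0]}=P_n$ and $P_n^{[k]}$ is monic of degree $n$. A pair $(\phi,\psi)$ is admissible if $\phi\in\mathcal{P}_2$, $\psi\in\mathcal{P}_1$ and $\psi'+\frac n2\phi''\ne0$ for all $n\in\mathbb{N}_0$ (i.e., with $\phi=ax^2+bx+c$, $\psi=px+q$, $na+p\neq 0$ for all $n\in\mathbb{N}_0$). In (C6), equality is between formal Laurent series in $1/z$, with termwise differentiation. *)

theory Defs
  imports "HOL-Computational_Algebra.Computational_Algebra"
begin

type_synonym functional = "complex poly \<Rightarrow> complex"

abbreviation is_functional :: "functional \<Rightarrow> bool" where
  "is_functional u \<equiv> Vector_Spaces.linear smult (*) u"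

definition moment :: "functional \<Rightarrow> nat \<Rightarrow> complex" where
  "moment u n = u (monom 1 n)"

definition pmult :: "complex poly \<Rightarrow> functional \<Rightarrow> functional" where
  "pmult \<phi> u = (\<lambda>p. u (\<phi> * p))"

definition fderiv :: "functional \<Rightarrow> functional" where
  "fderiv u = (\<lambda>p. - u (pderiv p))"

definition fscale :: "complex \<Rightarrow> functional \<Rightarrow> functional" where
  "fscale k u = (\<lambda>p. k * u p)"

definition OP_wrt :: "functional \<Rightarrow> (nat \<Rightarrow> complex poly) \<Rightarrow> bool" where
  "OP_wrt u P \<longleftrightarrow>
     (\<forall>n. P n \<noteq> 0 \<and> degree (P n) = n) \<and>
     (\<exists>\<kappa>. (\<forall>n. \<kappa> n \<noteq> 0) \<and> (\<forall>m n. u (P m * P n) = (if m = n then \<kappa> n else 0)))"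

definition monic_OP_wrt :: "functional \<Rightarrow> (nat \<Rightarrow> complex poly) \<Rightarrow> bool" where
  "monic_OP_wrt u P \<longleftrightarrow> OP_wrt u P \<and> (\<forall>n. lead_coeff (P n) = 1)"

definition monic_OP :: "(nat \<Rightarrow> complex poly) \<Rightarrow> bool" where
  "monic_OP P \<longleftrightarrow> (\<exists>v. is_functional v \<and> monic_OP_wrt v P)"

definition regular :: "functional \<Rightarrow> bool" where
  "regular u \<longleftrightarrow> is_functional u \<and> (\<exists>P. OP_wrt u P)"

text \<open>The polynomial with index \<open>n - 1\<close>, with the convention that the one with index \<open>-1\<close> is zero.\<close>
definition prev :: "(nat \<Rightarrow> complex poly) \<Rightarrow> nat \<Rightarrow> complex poly" where
  "prev P n = (if n = 0 then 0 else P (n - 1))"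

definition nderiv :: "(nat \<Rightarrow> complex poly) \<Rightarrow> nat \<Rightarrow> nat \<Rightarrow> complex poly" where
  "nderiv P k n = smult (1 / pochhammer (of_nat (n + 1)) k) ((pderiv ^^ k) (P (n + k)))"

definition admissible :: "complex poly \<Rightarrow> complex poly \<Rightarrow> bool" where
  "admissible \<phi> \<psi> \<longleftrightarrow> degree \<phi> \<le> 2 \<and> degree \<psi> \<le> 1 \<and>
     (\<forall>n::nat. pderiv \<psi> + smult (of_nat n / 2) (pderiv (pderiv \<phi>)) \<noteq> 0)"

text \<open>Formal Laurent series in \<open>1/z\<close> are represented as \<open>fls\<close> whose variable \<open>fls_X\<close> stands
  for \<open>w = 1/z\<close>. Hence \<open>z\<close> is \<open>fls_X_inv\<close>, and \<open>d/dz = - w^2 d/dw\<close>.\<close>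

definition poly_in_z :: "complex poly \<Rightarrow> complex fls" where
  "poly_in_z p = poly (map_poly fls_const p) fls_X_inv"

definition deriv_z :: "complex fls \<Rightarrow> complex fls" where
  "deriv_z F = - (fls_X ^ 2 * fls_deriv F)"

definition stieltjes :: "functional \<Rightarrow> complex fls" where
  "stieltjes u = - (fls_X * fps_to_fls (Abs_fps (moment u)))"

definition C1_for :: "functional \<Rightarrow> complex poly \<Rightarrow> complex poly \<Rightarrow> bool" where
  "C1_for u \<phi> \<psi> \<longleftrightarrow> \<phi> \<noteq> 0 \<and> \<psi> \<noteq> 0 \<and> degree \<phi> \<le> 2 \<and> degree \<psi> \<le> 1 \<and>
     fderiv (pmult \<phi> u) = pmult \<psi> u"

definition C1'_for :: "functional \<Rightarrow> complex poly \<Rightarrow> complex poly \<Rightarrow> bool" where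
  "C1'_for u \<phi> \<psi> \<longleftrightarrow> admissible \<phi> \<psi> \<and> fderiv (pmult \<phi> u) = pmult \<psi> u"

definition C2_with :: "(nat \<Rightarrow> complex poly) \<Rightarrow> complex poly \<Rightarrow>
    (nat \<Rightarrow> complex) \<Rightarrow> (nat \<Rightarrow> complex) \<Rightarrow> (nat \<Rightarrow> complex) \<Rightarrow> bool" where
  "C2_with P \<phi> a b c \<longleftrightarrow> degree \<phi> \<le> 2 \<and> (\<forall>n\<ge>1. c n \<noteq> 0) \<and>
     (\<forall>n. \<phi> * pderiv (P n) =
            smult (a n) (P (n + 1)) + smult (b n) (P n) + smult (c n) (prev P n))"

definition C4_with :: "(nat \<Rightarrow> complex poly) \<Rightarrow> nat \<Rightarrow>
    (nat \<Rightarrow> complex) \<Rightarrow> (nat \<Rightarrow> complex) \<Rightarrow> bool" where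
  "C4_with P k r s \<longleftrightarrow>
     (\<forall>n\<ge>2. nderiv P (k - 1) n =
        nderiv P k n + smult (r n) (nderiv P k (n - 1)) + smult (s n) (nderiv P k (n - 2)))"

definition C5_with :: "(nat \<Rightarrow> complex poly) \<Rightarrow> complex poly \<Rightarrow> complex poly \<Rightarrow>
    (nat \<Rightarrow> complex) \<Rightarrow> bool" where
  "C5_with P \<phi> \<psi> l \<longleftrightarrow> (\<forall>n\<ge>1. l n \<noteq> 0) \<and>
     (\<forall>n. \<phi> * pderiv (pderiv (P n)) + \<psi> * pderiv (P n) + smult (l n) (P n) = 0)"

definition C6_for :: "functional \<Rightarrow> complex poly \<Rightarrow> complex poly \<Rightarrow> bool" where
  "C6_for u \<phi> \<psi> \<longleftrightarrow> admissible \<phi> \<psi> \<and>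
     poly_in_z \<phi> * deriv_z (stieltjes u) =
       poly_in_z (\<psi> - pderiv \<phi>) * stieltjes u +
       poly_in_z (pderiv \<psi> - smult (1 / 2) (pderiv (pderiv \<phi>))) * fls_const (moment u 0)"

definition C7_with :: "(nat \<Rightarrow> complex poly) \<Rightarrow> complex poly \<Rightarrow> complex poly \<Rightarrow>
    (nat \<Rightarrow> complex) \<Rightarrow> (nat \<Rightarrow> complex) \<Rightarrow> bool" where
  "C7_with P \<phi> \<psi> h t \<longleftrightarrow> admissible \<phi> \<psi> \<and>
     (\<forall>n\<ge>1. \<phi> * pderiv (P n * P (n - 1)) =
        smult (h n) ((P n)\<^sup>2) - (\<psi> - pderiv \<phi>) * P n * P (n - 1) + smult (t n) ((P (n - 1))\<^sup>2))"

definition C8_with :: "functional \<Rightarrow> (nat \<Rightarrow> complex poly) \<Rightarrow> complex poly \<Rightarrow>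
    (nat \<Rightarrow> complex) \<Rightarrow> bool" where
  "C8_with u P \<phi> k \<longleftrightarrow> degree \<phi> \<le> 2 \<and> (\<forall>n. k n \<noteq> 0) \<and>
     (\<forall>n. pmult (P n) u = fscale (k n) ((fderiv ^^ n) (pmult (\<phi> ^ n) u)))"

definition C1 :: "functional \<Rightarrow> bool" where
  "C1 u \<longleftrightarrow> (\<exists>\<phi> \<psi>. C1_for u \<phi> \<psi>)"

definition C1' :: "functional \<Rightarrow> bool" where
  "C1' u \<longleftrightarrow> (\<exists>\<phi> \<psi>. C1'_for u \<phi> \<psi>)"

definition C2 :: "(nat \<Rightarrow> complex poly) \<Rightarrow> bool" where
  "C2 P \<longleftrightarrow> (\<exists>\<phi> a b c. C2_with P \<phi> a b c)"

definition C3 :: "(nat \<Rightarrow> complex poly) \<Rightarrow> bool" where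
  "C3 P \<longleftrightarrow> (\<exists>k\<ge>1. monic_OP (nderiv P k))"

definition C3' :: "(nat \<Rightarrow> complex poly) \<Rightarrow> bool" where
  "C3' P \<longleftrightarrow> (\<forall>k\<ge>1. monic_OP (nderiv P k))"

definition C4 :: "(nat \<Rightarrow> complex poly) \<Rightarrow> bool" where
  "C4 P \<longleftrightarrow> (\<exists>k\<ge>1. \<exists>r s. C4_with P k r s)"

definition C4' :: "(nat \<Rightarrow> complex poly) \<Rightarrow> bool" where
  "C4' P \<longleftrightarrow> (\<forall>k\<ge>1. \<exists>r s. C4_with P k r s)"

definition C5 :: "(nat \<Rightarrow> complex poly) \<Rightarrow> bool" where
  "C5 P \<longleftrightarrow> (\<exists>\<phi> \<psi> l. C5_with P \<phi> \<psi> l)"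

definition C6 :: "functional \<Rightarrow> bool" where
  "C6 u \<longleftrightarrow> (\<exists>\<phi> \<psi>. C6_for u \<phi> \<psi>)"

definition C7 :: "(nat \<Rightarrow> complex poly) \<Rightarrow> bool" where
  "C7 P \<longleftrightarrow> (\<exists>\<phi> \<psi> h t. C7_with P \<phi> \<psi> h t)"

definition C8 :: "functional \<Rightarrow> (nat \<Rightarrow> complex poly) \<Rightarrow> bool" where
  "C8 u P \<longleftrightarrow> (\<exists>\<phi> k. C8_with u P \<phi> k)"

definition TTRR :: "(nat \<Rightarrow> complex poly) \<Rightarrow> (nat \<Rightarrow> complex) \<Rightarrow> (nat \<Rightarrow> complex) \<Rightarrow> bool" where
  "TTRR P \<beta> \<gamma> \<longleftrightarrow> P 0 = 1 \<and>
     (\<forall>n. P (n + 1) = [:- \<beta> n, 1:] * P n - smult (\<gamma> n) (prev P n))"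

text \<open>The index is an integer because \<open>d_{-2}\<close> and \<open>d_{-1}\<close> occur in the formulas; the
  coefficients \<open>a, b, p, q\<close> are those of \<open>\<phi> = a x^2 + b x + c\<close> and \<open>\<psi> = p x + q\<close>.\<close>

definition dcoef :: "complex poly \<Rightarrow> complex poly \<Rightarrow> int \<Rightarrow> complex" where
  "dcoef \<phi> \<psi> m = of_int m * coeff \<phi> 2 + coeff \<psi> 1"

definition ecoef :: "complex poly \<Rightarrow> complex poly \<Rightarrow> int \<Rightarrow> complex" where
  "ecoef \<phi> \<psi> m = of_int m * coeff \<phi> 1 + coeff \<psi> 0"

text \<open>The separate cases \<open>n = 0\<close> and \<open>n = 1\<close> are the values after cancelling the common factors
  \<open>d_{-2}\<close> and \<open>d_{-1}\<close>, which may vanish.\<close>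

definition beta_formula :: "complex poly \<Rightarrow> complex poly \<Rightarrow> nat \<Rightarrow> complex" where
  "beta_formula \<phi> \<psi> n =
     (let d = dcoef \<phi> \<psi>; N = int n; b = coeff \<phi> 1; p = coeff \<psi> 1; q = coeff \<psi> 0 in
      if n = 0 then - q / p
      else - (d (-2) * q + 2 * b * of_nat n * d (N - 1)) / (d (2 * N) * d (2 * N - 2)))"

definition gamma_formula :: "complex poly \<Rightarrow> complex poly \<Rightarrow> nat \<Rightarrow> complex" where
  "gamma_formula \<phi> \<psi> n =
     (let d = dcoef \<phi> \<psi>; e = ecoef \<phi> \<psi>; N = int n; p = coeff \<psi> 1; q = coeff \<psi> 0 in
      if n = 1 then - poly \<phi> (- q / p) / d 1
      else - (of_nat n * d (N - 2) / (d (2 * N - 3) * d (2 * N - 1)))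
             * poly \<phi> (- e (N - 1) / d (2 * N - 2)))"

end

theory Submission
  imports Defs
begin

text \<open>
  Everything rests on the second-order operator \<open>L f = \<phi> f'' + \<psi> f'\<close>. The Pearson equation
  \<open>D(\<phi> u) = \<psi> u\<close> says precisely that \<open>u (L f * g) = - u (\<phi> f' g')\<close>. Hence \<open>L\<close> is symmetric for
  \<open>u\<close> and diagonal in the basis \<open>P n\<close>, with eigenvalue \<open>n d\<^sub>n\<^sub>-\<^sub>1\<close>; regularity of \<open>u\<close> excludes a zero
  eigenvalue for \<open>n \<ge> 1\<close>, which is admissibility. The same identity makes the derivatives
  \<open>P n'\<close> orthogonal with respect to \<open>\<phi> u\<close>, which is again classical, with \<open>\<psi> + \<phi>'\<close> in place of
  \<open>\<psi>\<close>; iterating gives (C3') and the Rodrigues formula (C8). Comparing coefficients in the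
  differential equation yields \<open>\<beta>\<close> and \<open>\<gamma>\<close>.

  Among the converses only (C3) and (C4) with \<open>k > 1\<close> are delicate. Subtracting the recurrence of the
  derived sequence from the derived recurrence turns (C3) into (C4), and (C4) produces polynomials
  \<open>q m\<close> of degree at most \<open>m + 1\<close> with \<open>D(q m u) = P m u\<close> for all \<open>m \<ge> k\<close>. The polynomials \<open>f\<close> for
  which \<open>D(f u)\<close> is a polynomial multiple of \<open>u\<close> form an ideal; its generator \<open>\<phi>\<close> has degree at most
  \<open>2\<close>, since otherwise the quotients \<open>q m / \<phi>\<close> would have bounded degree.
\<close>

section \<open>Functionals and orthogonal sequences\<close>

text \<open>\<open>Vector_Spaces.linear\<close> bundles two vector space structures; once these are
  discharged, linearity is available as two plain equations.\<close>

lemma is_functional_iff: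
  "is_functional u \<longleftrightarrow> (\<forall>p q. u (p + q) = u p + u q) \<and> (\<forall>c p. u (smult c p) = c * u p)"
proof -
  have "vector_space (smult :: complex \<Rightarrow> complex poly \<Rightarrow> complex poly)"
    by unfold_locales (simp_all add: smult_add_right smult_add_left)
  moreover have "vector_space ((*) :: complex \<Rightarrow> complex \<Rightarrow> complex)"
    by unfold_locales (simp_all add: algebra_simps)
  ultimately show ?thesis
    by (auto simp: Vector_Spaces.linear_def module_hom_def module_hom_axioms_def
        vector_space_def module_def)
qed

context
  fixes u :: functional
  assumes functional: "is_functional u"
begin

lemma functional_add: "u (p + q) = u p + u q"
  and functional_smult: "u (smult c p) = c * u p"
  using functional by (auto simp: is_functional_iff)

lemma functional_zero: "u 0 = 0"
  using functional_smult[of 0 0] by simp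

lemma functional_uminus: "u (- p) = - u p"
  using functional_smult[of "-1" p] by simp

lemma functional_diff: "u (p - q) = u p - u q"
  using functional_add[of p "- q"] functional_uminus[of q] by simp

lemma functional_sum: "u (sum f A) = (\<Sum>x\<in>A. u (f x))"
  by (induction A rule: infinite_finite_induct) (simp_all add: functional_add functional_zero)

lemmas functional_simps =
  functional_add functional_smult functional_zero functional_uminus functional_diff functional_sum

lemma is_functional_pmult: "is_functional (pmult \<phi> u)"
  by (simp add: is_functional_iff pmult_def functional_simps distrib_left)

end

text \<open>Bringing both terms to one side turns a Pearson equation into the vanishing of a single
  linear functional, which can be tested on any convenient basis.\<close>

lemma fderiv_pmult_eq_iff:
  assumes "is_functional u"
  shows "fderiv (pmult f u) = pmult g u \<longleftrightarrow> (\<forall>p. u (f * pderiv p + g * p) = 0)"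
  using functional_add[OF assms] by (auto simp: fderiv_def pmult_def fun_eq_iff eq_neg_iff_add_eq_0
     add.commute neg_eq_iff_add_eq_0)

lemma quadratic_pCons:
  fixes f :: "'a::zero poly"
  assumes "degree f \<le> 2"
  shows "f = [:coeff f 0, coeff f 1, coeff f 2:]"
  using assms by (auto simp: poly_eq_iff coeff_pCons coeff_eq_0 eval_nat_numeral split: nat.splits)

lemma linear_pCons:
  fixes f :: "'a::zero poly"
  assumes "degree f \<le> 1"
  shows "f = [:coeff f 0, coeff f 1:]"
  using assms by (auto simp: poly_eq_iff coeff_pCons coeff_eq_0 split: nat.splits)

text \<open>The leading factor is the number d_n. With \<psi> = 0 the lemma also yields the leading
  coefficient of \<open>\<phi> * pderiv f\<close>.\<close>

lemma coeff_quadratic_mult_pderiv: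
  fixes \<phi> \<psi> f :: "complex poly"
  assumes "degree \<phi> \<le> 2" "degree \<psi> \<le> 1" "degree f \<le> n"
  shows "coeff (\<phi> * pderiv f + \<psi> * f) (Suc n) = (of_nat n * coeff \<phi> 2 + coeff \<psi> 1) * coeff f n"
  using coeff_eq_0[of f "Suc n"] coeff_eq_0[of f "Suc (Suc n)"] assms(3)
  by (subst quadratic_pCons[OF assms(1)], subst linear_pCons[OF assms(2)])
     (cases n; simp add: coeff_pderiv algebra_simps)

text \<open>Kept free of any functional, so that it also applies to the monomials and to derived
  sequences whose orthogonality is not yet known.\<close>

locale monic_graded =
  fixes P :: "nat \<Rightarrow> complex poly"
  assumes degree_P [simp]: "degree (P n) = n"
    and coeff_P [simp]: "coeff (P n) n = 1"
begin

lemma P_nonzero [simp]: "P n \<noteq> 0"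
  using coeff_P[of n] by (metis coeff_0 zero_neq_one)

lemma P_0 [simp]: "P 0 = 1"
proof -
  obtain a where "P 0 = [:a:]" using degree_P[of 0] by (rule degree_eq_zeroE)
  with coeff_P[of 0] show ?thesis by simp
qed

lemma graded_expansion:
  assumes "degree f \<le> n"
  obtains c where "f = (\<Sum>j\<le>n. smult (c j) (P j))"
proof -
  have "\<exists>c. f = (\<Sum>j\<le>n. smult (c j) (P j))" using assms
  proof (induction n arbitrary: f)
    case 0
    then obtain a where "f = [:a:]" by (auto elim!: degree_eq_zeroE)
    then show ?case by (intro exI[of _ "\<lambda>_. a"]) simp
  next
    case (Suc n)
    let ?g = "f - smult (coeff f (Suc n)) (P (Suc n))"
    have "degree ?g \<le> Suc n"
      using Suc.prems by (intro degree_diff_le) (auto intro: order_trans[OF degree_smult_le])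
    moreover have "coeff ?g (Suc n) = 0"
      by simp
    ultimately have "degree ?g \<le> n"
      by (metis eq_zero_or_degree_less less_Suc_eq_le degree_0 le0)
    then obtain c where c: "?g = (\<Sum>j\<le>n. smult (c j) (P j))"
      using Suc.IH by blast
    have "f = (\<Sum>j\<le>Suc n. smult ((c(Suc n := coeff f (Suc n))) j) (P j))"
    proof -
      have "f = ?g + smult (coeff f (Suc n)) (P (Suc n))" by simp
      also have "\<dots> = (\<Sum>j\<le>Suc n. smult ((c(Suc n := coeff f (Suc n))) j) (P j))"
        unfolding c by simp
      finally show ?thesis .
    qed
    then show ?case by blast
  qed
  with that show thesis by blast
qed

lemma linear_condition_extend:
  assumes "is_functional w" "\<And>j. w (P j) = 0"
  shows "w f = 0"
proof -
  obtain c where "f = (\<Sum>j\<le>degree f. smult (c j) (P j))"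
    using graded_expansion[OF order_refl] by blast
  then have "w f = w (\<Sum>j\<le>degree f. smult (c j) (P j))" by simp
  then show ?thesis by (simp add: functional_simps[OF assms(1)] assms(2))
qed

end

section \<open>Orthogonality, three-term combinations and the recurrence\<close>

locale monic_ops =
  fixes u :: functional and P :: "nat \<Rightarrow> complex poly"
  assumes functional: "is_functional u" and ops: "monic_OP_wrt u P"
begin

sublocale monic_graded P
  using ops by unfold_locales (auto simp: monic_OP_wrt_def OP_wrt_def)

lemmas u_simps = functional_simps[OF functional]

definition \<kappa> :: "nat \<Rightarrow> complex" where "\<kappa> n = u (P n * P n)"

lemma u_P_P: "u (P m * P n) = (if m = n then \<kappa> n else 0)"
  and kappa_nonzero [simp]: "\<kappa> n \<noteq> 0"
proof -
  obtain k where "\<forall>n. k n \<noteq> 0" and k: "\<forall>m n. u (P m * P n) = (if m = n then k n else 0)"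
    using ops by (auto simp: monic_OP_wrt_def OP_wrt_def)
  moreover have "\<kappa> = k" by (simp add: \<kappa>_def fun_eq_iff k)
  ultimately show "u (P m * P n) = (if m = n then \<kappa> n else 0)" "\<kappa> n \<noteq> 0" by simp_all
qed

text \<open>In the expansion of f only the term with \<open>P n\<close> survives the pairing, and
  its coefficient is \<open>coeff f n\<close> because the basis is monic.\<close>

lemma u_P_times:
  assumes "degree f \<le> n"
  shows "u (P n * f) = coeff f n * \<kappa> n" "u (f * P n) = coeff f n * \<kappa> n"
proof -
  obtain c where c: "f = (\<Sum>j\<le>n. smult (c j) (P j))"
    using graded_expansion[OF assms] by blast
  have "coeff f n = (\<Sum>j\<le>n. c j * coeff (P j) n)"
    by (simp add: c coeff_sum)
  also have "\<dots> = (\<Sum>j\<le>n. if j = n then c n else 0)"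
    by (intro sum.cong) (auto simp: coeff_eq_0)
  finally have cn: "coeff f n = c n" by simp
  have "u (P n * f) = (\<Sum>j\<le>n. c j * u (P n * P j))"
    by (simp add: c sum_distrib_left u_simps)
  also have "\<dots> = (\<Sum>j\<le>n. if j = n then c n * \<kappa> n else 0)"
    by (intro sum.cong) (auto simp: u_P_P)
  finally show "u (P n * f) = coeff f n * \<kappa> n" by (simp add: cn)
  then show "u (f * P n) = coeff f n * \<kappa> n" by (simp add: mult.commute)
qed

lemma u_P_times_eq_0:
  assumes "degree f < n"
  shows "u (P n * f) = 0" "u (f * P n) = 0"
  using u_P_times[of f n] assms by (simp_all add: coeff_eq_0)

text \<open>Pairing a nonzero f with \<open>P (degree f)\<close> returns its leading coefficient
  times a nonzero \<kappa>. Regularity thus acts as a cancellation law for u.\<close>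

lemma zero_if_orthogonal_basis:
  assumes "\<And>j. u (f * P j) = 0"
  shows "f = 0"
proof (rule ccontr)
  assume "f \<noteq> 0"
  have "u (f * P (degree f)) = lead_coeff f * \<kappa> (degree f)"
    by (rule u_P_times) simp
  with assms \<open>f \<noteq> 0\<close> show False by simp
qed

lemma zero_if_orthogonal: "(\<And>p. u (f * p) = 0) \<Longrightarrow> f = 0"
  using zero_if_orthogonal_basis by blast

lemma eq_if_orthogonal_basis:
  assumes "\<And>j. u (f * P j) = u (g * P j)"
  shows "f = g"
  using zero_if_orthogonal_basis[of "f - g"] assms by (simp add: left_diff_distrib u_simps)

text \<open>Pairings read off the coefficients of a three-term combination. The case
  \<open>Suc j = n\<close> is void for n = 0, in accordance with \<open>prev\<close>.\<close>

lemma u_P_combination: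
  "u ((smult a (P (Suc n)) + smult b (P n) + smult c (prev P n)) * P j) =
    (if j = Suc n then a * \<kappa> j else if j = n then b * \<kappa> j else if Suc j = n then c * \<kappa> j else 0)"
  by (auto simp: distrib_right u_simps prev_def u_P_P)

lemma three_term_unique:
  assumes "smult a (P (Suc n)) + smult b (P n) + smult c (prev P n) =
    smult a' (P (Suc n)) + smult b' (P n) + smult c' (prev P n)"
  shows "a = a'" "b = b'" "n \<ge> 1 \<Longrightarrow> c = c'"
proof -
  have eq: "u ((smult a (P (Suc n)) + smult b (P n) + smult c (prev P n)) * P j) =
    u ((smult a' (P (Suc n)) + smult b' (P n) + smult c' (prev P n)) * P j)" for j
    using assms by simp
  from eq[of "Suc n"] show "a = a'" by (simp add: u_P_combination)
  from eq[of n] show "b = b'" by (simp add: u_P_combination)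
  assume "n \<ge> 1"
  then obtain k where "n = Suc k" by (cases n) auto
  with eq[of k] show "c = c'" by (simp add: u_P_combination)
qed

text \<open>These are the coefficients of x P n in the basis P. Truncated subtraction gives
  \<open>\<gamma> 0 = 1\<close>, a value that multiplies \<open>prev P 0 = 0\<close> in the
  recurrence.\<close>

definition \<beta> :: "nat \<Rightarrow> complex" where "\<beta> n = u (pCons 0 (P n) * P n) / \<kappa> n"
definition \<gamma> :: "nat \<Rightarrow> complex" where "\<gamma> n = \<kappa> n / \<kappa> (n - 1)"

lemma gamma_nonzero [simp]: "\<gamma> n \<noteq> 0"
  by (simp add: \<gamma>_def)

text \<open>Multiplication by x is symmetric for u, so for j \<noteq> n the factor x is moved to the
  polynomial of lower degree and the pairing becomes a leading coefficient.\<close>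

lemma pCons_P: "pCons 0 (P n) = P (Suc n) + smult (\<beta> n) (P n) + smult (\<gamma> n) (prev P n)"
proof (rule eq_if_orthogonal_basis)
  fix j
  have *: "pCons 0 (P n) * P j = P n * pCons 0 (P j)" by simp
  have "u (pCons 0 (P n) * P j) = (if j = Suc n then 1 * \<kappa> j else if j = n then \<beta> n * \<kappa> j else
    if Suc j = n then \<gamma> n * \<kappa> j else 0)"
  proof (cases "Suc j \<le> n")
    case True
    then have "degree (pCons 0 (P j)) \<le> n" by (simp add: degree_pCons_eq)
    then have "u (pCons 0 (P n) * P j) = coeff (pCons 0 (P j)) n * \<kappa> n"
      unfolding * by (rule u_P_times)
    moreover have "coeff (pCons 0 (P j)) n = (if Suc j = n then 1 else 0)"
      using True by (auto simp: coeff_pCons coeff_eq_0 split: nat.splits)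
    ultimately show ?thesis using True by (auto simp: \<gamma>_def)
  next
    case False
    show ?thesis
    proof (cases "j = n")
      case True then show ?thesis by (simp add: \<beta>_def)
    next
      case False
      with \<open>\<not> Suc j \<le> n\<close> have "Suc n \<le> j" by simp
      then have "u (pCons 0 (P n) * P j) = coeff (pCons 0 (P n)) j * \<kappa> j"
        by (intro u_P_times) (simp add: degree_pCons_eq)
      moreover have "coeff (pCons 0 (P n)) j = (if j = Suc n then 1 else 0)"
        using \<open>Suc n \<le> j\<close> by (auto simp: coeff_pCons coeff_eq_0 split: nat.splits)
      ultimately show ?thesis using \<open>Suc n \<le> j\<close> by auto
    qed
  qed
  then show "u (pCons 0 (P n) * P j) =
      u ((P (Suc n) + smult (\<beta> n) (P n) + smult (\<gamma> n) (prev P n)) * P j)"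
    using u_P_combination[of 1 n "\<beta> n" "\<gamma> n" j] by simp
qed

lemma P_Suc: "P (Suc n) = [:- \<beta> n, 1:] * P n - smult (\<gamma> n) (prev P n)"
  using pCons_P[of n] by (simp add: algebra_simps)

lemma TTRR_P: "TTRR P \<beta> \<gamma>"
  by (simp add: TTRR_def P_Suc)

text \<open>This is the coprimality of \<open>P n\<close> and \<open>P (Suc n)\<close> in the form in which it is used.\<close>
lemma dvd_if_dvd_mult_P_Suc: "P n dvd f * P (Suc n) \<Longrightarrow> P n dvd f"
proof (induction n arbitrary: f)
  case (Suc n)
  have "smult (\<gamma> (Suc n)) (P n) = [:- \<beta> (Suc n), 1:] * P (Suc n) - P (Suc (Suc n))"
    using P_Suc[of "Suc n"] by (simp add: prev_def)
  then have "smult (\<gamma> (Suc n)) (f * P n) = f * ([:- \<beta> (Suc n), 1:] * P (Suc n)) - f * P (Suc (Suc n))"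
    by (metis mult_smult_right right_diff_distrib)
  then have "P (Suc n) dvd smult (\<gamma> (Suc n)) (f * P n)"
    using Suc.prems by (metis dvd_diff dvd_mult dvd_triv_right)
  then have "P (Suc n) dvd f * P n" by (rule dvd_smult_cancel) simp
  \<comment> \<open>The induction hypothesis is applied to this cofactor g rather than to f, which
    is why f is arbitrary in the induction.\<close>
  then obtain g where g: "f * P n = g * P (Suc n)" by (metis dvdE mult.commute)
  then have "P n dvd g * P (Suc n)" by (metis dvd_triv_right)
  then have "P n dvd g" by (rule Suc.IH)
  then obtain g' where "g = P n * g'" by (elim dvdE)
  with g have "f * P n = (P (Suc n) * g') * P n" by (simp add: mult_ac)
  then show ?case by simp
qed simp

end

section \<open>Normalized derivatives and differential operators on polynomials\<close>

lemma nderiv_0: "nderiv P 0 = P"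
  by (simp add: nderiv_def fun_eq_iff)

text \<open>Reduces questions about \<open>nderiv P k\<close> to repeated passage to the first
  derivative.\<close>

lemma nderiv_nderiv_1: "nderiv (nderiv P k) 1 = nderiv P (Suc k)"
proof
  fix n
  show "nderiv (nderiv P k) 1 n = nderiv P (Suc k) n"
    by (simp add: nderiv_def pderiv_smult pochhammer_rec add.commute)
qed

lemma pochhammer_of_nat_nonzero: "pochhammer (of_nat (Suc n)) k \<noteq> (0 :: complex)"
  by (metis pochhammer_of_nat pochhammer_pos zero_less_Suc of_nat_eq_0_iff less_irrefl)

context monic_graded
begin

lemma higher_pderiv_P:
  "(pderiv ^^ k) (P (n + k)) = smult (pochhammer (of_nat (n + 1)) k) (nderiv P k n)"
  using pochhammer_of_nat_nonzero[of n k] by (simp add: nderiv_def)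

lemma pderiv_P: "pderiv (P (Suc n)) = smult (of_nat (Suc n)) (nderiv P 1 n)"
  using higher_pderiv_P[of 1 n] by simp

lemma monic_graded_nderiv: "monic_graded (nderiv P k)"
proof
  fix n
  note nz = pochhammer_of_nat_nonzero[of n k]
  then show "degree (nderiv P k n) = n"
    by (simp add: nderiv_def degree_higher_pderiv)
  show "coeff (nderiv P k n) n = 1"
    using nz by (simp add: nderiv_def coeff_higher_pderiv)
qed

text \<open>The derivatives of the basis polynomials span all polynomials.\<close>
lemma functional_eq_0_if_pderiv:
  assumes "is_functional w" "\<And>n. w (pderiv (P (Suc n))) = 0"
  shows "w f = 0"
proof -
  have "w (nderiv P 1 n) = 0" for n
    using assms(2)[of n] of_nat_neq_0[of n, where ?'a = complex]
    by (simp add: pderiv_P functional_smult[OF assms(1)] del: of_nat_Suc)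
  then show ?thesis
    by (rule monic_graded.linear_condition_extend[OF monic_graded_nderiv assms(1)])
qed

end

lemma degree_quadratic_mult_pderiv:
  fixes \<phi> \<psi> f :: "complex poly"
  assumes "degree \<phi> \<le> 2" "degree \<psi> \<le> 1" "degree f \<le> n"
  shows "degree (\<phi> * pderiv f + \<psi> * f) \<le> Suc n"
proof (rule degree_add_le)
  show "degree (\<psi> * f) \<le> Suc n"
    using degree_mult_le[of \<psi> f] assms by linarith
  show "degree (\<phi> * pderiv f) \<le> Suc n"
  proof (cases "n = 0")
    case True
    then have "pderiv f = 0" using assms(3) by (simp add: pderiv_eq_0_iff)
    then show ?thesis by simp
  next
    case False
    then show ?thesis
      using degree_mult_le[of \<phi> "pderiv f"] assms by (simp add: degree_pderiv)
  qed
qed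

text \<open>On monomials the operator is triangular with diagonal entries m d(m-1). The two entries
  off the diagonal later determine the second and third coefficients of \<open>P n\<close>.\<close>

lemma coeff_second_order:
  fixes \<phi> \<psi> f :: "complex poly"
  assumes "degree \<phi> \<le> 2" "degree \<psi> \<le> 1"
  shows "coeff (\<phi> * pderiv (pderiv f) + \<psi> * pderiv f) m =
    of_nat m * dcoef \<phi> \<psi> (int m - 1) * coeff f m +
    of_nat (m + 1) * ecoef \<phi> \<psi> (int m) * coeff f (m + 1) +
    of_nat ((m + 2) * (m + 1)) * coeff \<phi> 0 * coeff f (m + 2)"
proof -
  define a b c p q where "a = coeff \<phi> 2" "b = coeff \<phi> 1" "c = coeff \<phi> 0" "p = coeff \<psi> 1" "q = coeff \<psi> 0"
  have eqs: "\<phi> = [:c, b, a:]" "\<psi> = [:q, p:]"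
    using quadratic_pCons[OF assms(1)] linear_pCons[OF assms(2)] by (simp_all add: a_b_c_p_q_def)
  have "coeff ([:c, b, a:] * pderiv (pderiv f) + [:q, p:] * pderiv f) m =
    of_nat m * (of_int (int m - 1) * a + p) * coeff f m +
    of_nat (m + 1) * (of_nat m * b + q) * coeff f (m + 1) +
    of_nat ((m + 2) * (m + 1)) * c * coeff f (m + 2)"
  proof (cases m)
    case (Suc k)
    then show ?thesis by (cases k) (simp_all add: coeff_pderiv algebra_simps)
  qed (simp add: coeff_pderiv algebra_simps)
  then show ?thesis
    unfolding eqs[symmetric] by (simp add: dcoef_def ecoef_def a_b_c_p_q_def)
qed

section \<open>Consequences of the Pearson equation\<close>

locale classical = monic_ops +
  fixes \<phi> \<psi> :: "complex poly"
  assumes phi_nonzero: "\<phi> \<noteq> 0"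
    and degree_phi: "degree \<phi> \<le> 2"
    and degree_psi: "degree \<psi> \<le> 1"
    and pearson: "fderiv (pmult \<phi> u) = pmult \<psi> u"
begin

abbreviation "d \<equiv> dcoef \<phi> \<psi>"
abbreviation "e \<equiv> ecoef \<phi> \<psi>"

definition L :: "complex poly \<Rightarrow> complex poly" where
  "L f = \<phi> * pderiv (pderiv f) + \<psi> * pderiv f"

lemma u_pearson: "u (\<phi> * pderiv f + \<psi> * f) = 0"
  using pearson by (simp add: fderiv_pmult_eq_iff[OF functional])

text \<open>Integration by parts: this is the Pearson equation tested on
  \<open>pderiv f * g\<close>.\<close>

lemma u_L_times: "u (L f * g) = - u (\<phi> * pderiv f * pderiv g)"
proof -
  have "L f * g + \<phi> * pderiv f * pderiv g = \<phi> * pderiv (pderiv f * g) + \<psi> * (pderiv f * g)"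
    by (simp add: L_def pderiv_mult algebra_simps)
  then have "u (L f * g) + u (\<phi> * pderiv f * pderiv g) = 0"
    by (metis u_pearson u_simps(1))
  then show ?thesis by (simp add: add_eq_0_iff)
qed

lemma u_L_symmetric: "u (L f * g) = u (f * L g)"
  using u_L_times[of f g] u_L_times[of g f] by (simp add: mult_ac)

lemma coeff_L:
  "coeff (L f) m = of_nat m * d (int m - 1) * coeff f m + of_nat (m + 1) * e (int m) * coeff f (m + 1) +
    of_nat ((m + 2) * (m + 1)) * coeff \<phi> 0 * coeff f (m + 2)"
  unfolding L_def by (rule coeff_second_order[OF degree_phi degree_psi])

lemma degree_L: "degree (L f) \<le> degree f"
  by (rule degree_le) (simp add: coeff_L coeff_eq_0)

text \<open>\<open>L\<close> does not raise degrees. For j > n this alone kills the pairing with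
  \<open>P j\<close>; for j \<le> n symmetry first moves \<open>L\<close> onto \<open>P j\<close>.
  The eigenvalue is the diagonal entry of \<open>L\<close>.\<close>

lemma L_P: "L (P n) = smult (of_nat n * d (int n - 1)) (P n)"
proof (rule eq_if_orthogonal_basis)
  fix j
  have "u (L (P n) * P j) = (if j = n then of_nat n * d (int n - 1) * \<kappa> n else 0)"
  proof (cases "j \<le> n")
    case True
    then have "u (P n * L (P j)) = coeff (L (P j)) n * \<kappa> n"
      using degree_L[of "P j"] by (intro u_P_times) simp
    then show ?thesis
      using True by (auto simp: u_L_symmetric coeff_L coeff_eq_0)
  next
    case False
    then have "u (L (P n) * P j) = 0"
      using degree_L[of "P n"] by (intro u_P_times_eq_0) simp
    then show ?thesis using False by simp
  qed
  then show "u (L (P n) * P j) = u (smult (of_nat n * d (int n - 1)) (P n) * P j)"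
    by (simp add: u_simps u_P_P)
qed

lemma ode: "\<phi> * pderiv (pderiv (P n)) + \<psi> * pderiv (P n) = smult (of_nat n * d (int n - 1)) (P n)"
  using L_P[of n] by (simp add: L_def)

text \<open>If \<open>d n\<close> vanished then \<open>L (P (n + 1)) = 0\<close>, so \<open>\<phi> * pderiv (P (n + 1))\<close> would be
  orthogonal to every derivative, that is, to every polynomial.\<close>
lemma d_of_nat_nonzero: "d (int n) \<noteq> 0"
proof
  assume "d (int n) = 0"
  then have "L (P (Suc n)) = 0" by (simp add: L_P)
  then have *: "u (\<phi> * pderiv (P (Suc n)) * pderiv g) = 0" for g
    using u_L_times[of "P (Suc n)" g] by (simp add: u_simps)
  have "u (\<phi> * pderiv (P (Suc n)) * f) = 0" for f
    using functional_eq_0_if_pderiv[OF is_functional_pmult[OF functional, of "\<phi> * pderiv (P (Suc n))"], of f]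
    by (simp add: pmult_def *)
  then have "\<phi> * pderiv (P (Suc n)) = 0" by (rule zero_if_orthogonal)
  then show False using phi_nonzero by (simp add: pderiv_eq_0_iff)
qed

lemma d_nonzero: "m \<ge> 0 \<Longrightarrow> d m \<noteq> 0"
  using d_of_nat_nonzero[of "nat m"] by simp

lemma psi_coeff_1_nonzero: "coeff \<psi> 1 \<noteq> 0"
  using d_nonzero[of 0] by (simp add: dcoef_def)

lemma phi_eq: "\<phi> = [:coeff \<phi> 0, coeff \<phi> 1, coeff \<phi> 2:]"
  and psi_eq: "\<psi> = [:coeff \<psi> 0, coeff \<psi> 1:]"
  using quadratic_pCons[OF degree_phi] linear_pCons[OF degree_psi] by simp_all

lemma poly_psi: "poly \<psi> x = coeff \<psi> 1 * x + coeff \<psi> 0"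
  by (subst psi_eq) simp

lemma poly_phi: "poly \<phi> x = coeff \<phi> 2 * x^2 + coeff \<phi> 1 * x + coeff \<phi> 0"
  by (subst phi_eq) (simp add: power2_eq_square algebra_simps)

lemma u_psi_P_P: "u (\<psi> * (P n * P n)) = poly \<psi> (\<beta> n) * \<kappa> n"
proof -
  have "\<psi> * (P n * P n) = smult (coeff \<psi> 0) (P n * P n) + smult (coeff \<psi> 1) (pCons 0 (P n) * P n)"
    by (subst psi_eq) (simp add: algebra_simps)
  then have "u (\<psi> * (P n * P n)) = coeff \<psi> 0 * \<kappa> n + coeff \<psi> 1 * u (pCons 0 (P n) * P n)"
    by (simp only: u_simps \<kappa>_def)
  then show ?thesis
    by (simp only: poly_psi \<beta>_def) (simp add: field_simps)
qed

text \<open>The pairing with \<open>P j\<close> is found by degree for j > n, by the Pearson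
  equation on \<open>P n * P n\<close> for j = n, and by the Pearson equation on
  \<open>P n * P j\<close> for j < n, which moves the derivative to the factor of lower
  degree.\<close>

lemma structure_relation:
  "\<phi> * pderiv (P n) = smult (of_nat n * coeff \<phi> 2) (P (Suc n)) + smult (- (1/2) * poly \<psi> (\<beta> n)) (P n) +
    smult (- d (int n - 1) * \<gamma> n) (prev P n)"
proof (rule eq_if_orthogonal_basis)
  fix j
  consider "j \<ge> Suc n" | "j = n" | "j < n" by linarith
  then have "u (\<phi> * pderiv (P n) * P j) = (if j = Suc n then of_nat n * coeff \<phi> 2 * \<kappa> j
    else if j = n then - (1/2) * poly \<psi> (\<beta> n) * \<kappa> j
    else if Suc j = n then - d (int n - 1) * \<gamma> n * \<kappa> j else 0)"
  proof cases
    case 1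
    have deg: "degree (\<phi> * pderiv (P n)) \<le> Suc n"
      using degree_quadratic_mult_pderiv[OF degree_phi, of 0 "P n" n] by simp
    then have "u (\<phi> * pderiv (P n) * P j) = coeff (\<phi> * pderiv (P n)) j * \<kappa> j"
      using 1 by (intro u_P_times) simp
    moreover have "coeff (\<phi> * pderiv (P n)) (Suc n) = of_nat n * coeff \<phi> 2"
      using coeff_quadratic_mult_pderiv[OF degree_phi, of 0 "P n" n] by simp
    ultimately show ?thesis using 1 deg by (auto simp: coeff_eq_0)
  next
    case 2
    \<comment> \<open>The derivative of the square contains the wanted pairing twice, hence the
      factor 1/2.\<close>
    have "\<phi> * pderiv (P n * P n) + \<psi> * (P n * P n) =
        \<phi> * pderiv (P n) * P n + \<phi> * pderiv (P n) * P n + \<psi> * (P n * P n)"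
      by (simp add: pderiv_mult algebra_simps)
    then have "2 * u (\<phi> * pderiv (P n) * P n) + u (\<psi> * (P n * P n)) = 0"
      using u_pearson[of "P n * P n"] by (simp only: u_simps mult_2)
    then show ?thesis using 2 by (simp add: u_psi_P_P field_simps eq_neg_iff_add_eq_0)
  next
    case 3
    let ?f = "\<phi> * pderiv (P j) + \<psi> * P j"
    have deg: "degree ?f \<le> Suc j"
      by (rule degree_quadratic_mult_pderiv[OF degree_phi degree_psi]) simp
    have "u (\<phi> * pderiv (P n) * P j) = - u (P n * ?f)"
      using u_pearson[of "P n * P j"]
      by (simp add: pderiv_mult u_simps algebra_simps add_eq_0_iff)
    also have "u (P n * ?f) = coeff ?f n * \<kappa> n"
      using deg 3 by (intro u_P_times) simp
    also have "coeff ?f n = (if Suc j = n then d (int n - 1) else 0)"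
      using coeff_quadratic_mult_pderiv[OF degree_phi degree_psi, of "P j" j] deg 3
        coeff_eq_0[of ?f n]
      by (auto simp: dcoef_def simp del: coeff_add)
    finally show ?thesis using 3 by (auto simp: \<gamma>_def)
  qed
  then show "u (\<phi> * pderiv (P n) * P j) =
    u ((smult (of_nat n * coeff \<phi> 2) (P (Suc n)) + smult (- (1/2) * poly \<psi> (\<beta> n)) (P n) +
      smult (- d (int n - 1) * \<gamma> n) (prev P n)) * P j)"
    by (simp only: u_P_combination)
qed

section \<open>Recurrence coefficients from the second and third coefficients of
  \<open>P n\<close>\<close>

definition sub1 :: "nat \<Rightarrow> complex" where "sub1 n = (if n = 0 then 0 else coeff (P n) (n - 1))"

lemma beta_eq_sub1: "\<beta> n = sub1 n - sub1 (Suc n)"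
  using arg_cong[OF P_Suc[of n], of "\<lambda>f. coeff f n"]
  by (cases n) (auto simp: sub1_def prev_def coeff_pCons coeff_eq_0 split: nat.splits)

text \<open>Compares coefficients of x^(n-1) in the eigenvalue equation; eigenvalue minus diagonal
  entry is n d(n-1) - (n-1) d(n-2) = d(2n-2).\<close>

lemma d_times_sub1: "d (2 * int n - 2) * sub1 n = of_nat n * e (int n - 1)"
proof (cases n)
  case (Suc m)
  have "coeff (L (P (Suc m))) m = of_nat (Suc m) * d (int m) * sub1 n"
    by (simp add: L_P Suc sub1_def)
  then show ?thesis
    by (simp add: coeff_L coeff_eq_0 Suc sub1_def dcoef_def algebra_simps)
qed (simp add: sub1_def)

lemma beta_0: "\<beta> 0 = - coeff \<psi> 0 / coeff \<psi> 1"
  using d_times_sub1[of 1] psi_coeff_1_nonzero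
  by (simp add: beta_eq_sub1[of 0] dcoef_def ecoef_def field_simps sub1_def[of 0])

text \<open>Stated without division so that it can also enter the polynomial identity behind
  (C4).\<close>

lemma d_d_beta:
  assumes "n \<ge> 1"
  shows "d (2 * int n) * d (2 * int n - 2) * \<beta> n =
    - (d (-2) * coeff \<psi> 0 + 2 * coeff \<phi> 1 * of_nat n * d (int n - 1))"
proof -
  have "d (2 * int n) * d (2 * int n - 2) * \<beta> n = d (2 * int n) * (d (2 * int n - 2) * sub1 n)
    - d (2 * int n - 2) * (d (2 * int (Suc n) - 2) * sub1 (Suc n))"
    by (simp add: beta_eq_sub1 algebra_simps)
  also have "\<dots> = - (d (-2) * coeff \<psi> 0 + 2 * coeff \<phi> 1 * of_nat n * d (int n - 1))"
    unfolding d_times_sub1 by (simp add: dcoef_def ecoef_def algebra_simps)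
  finally show ?thesis .
qed

lemma beta_eq: "\<beta> n = beta_formula \<phi> \<psi> n"
proof (cases "n = 0")
  case False
  then have "d (2 * int n) \<noteq> 0" "d (2 * int n - 2) \<noteq> 0" by (simp_all add: d_nonzero)
  then show ?thesis
    using d_d_beta[of n] False by (simp add: beta_formula_def Let_def field_simps)
qed (simp add: beta_formula_def Let_def beta_0)

definition sub2 :: "nat \<Rightarrow> complex" where "sub2 n = (if n < 2 then 0 else coeff (P n) (n - 2))"

lemma gamma_eq_sub2: "n \<ge> 1 \<Longrightarrow> \<gamma> n = sub2 n - sub2 (Suc n) - \<beta> n * sub1 n"
  using arg_cong[OF P_Suc[of n], of "\<lambda>f. coeff f (n - 1)"]
  by (cases n; cases "n - 1")
     (auto simp: sub1_def sub2_def prev_def coeff_pCons coeff_eq_0 split: nat.splits)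

text \<open>The same comparison at x^(n-2), where n d(n-1) - (n-2) d(n-3) = 2 d(2n-3).\<close>

lemma d_times_sub2:
  "n \<ge> 1 \<Longrightarrow> 2 * d (2 * int n - 3) * sub2 n = of_nat (n - 1) * (e (int n - 2) * sub1 n + of_nat n * coeff \<phi> 0)"
proof (cases "n < 2")
  case False
  then obtain m where n: "n = Suc (Suc m)" by (metis add_2_eq_Suc less_eqE linorder_not_less)
  have "coeff (L (P n)) m = of_nat n * d (int n - 1) * sub2 n"
    by (simp add: L_P n sub2_def)
  then show ?thesis
    by (simp add: coeff_L coeff_eq_0 n sub1_def sub2_def dcoef_def algebra_simps)
qed (auto simp: sub2_def)

text \<open>All d and e that occur are shifts of D = d(2n-2) and E = e(n-1) by multiples of a and b.
  After eliminating \<open>sub1\<close> and \<open>sub2\<close>, a rational identity in a, b, c, D,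
  E, N remains.\<close>

lemma gamma_eq:
  assumes "n \<ge> 1"
  shows "\<gamma> n = gamma_formula \<phi> \<psi> n"
proof -
  define a b c D E N where "a = coeff \<phi> 2" "b = coeff \<phi> 1" "c = coeff \<phi> 0"
    "D = d (2 * int n - 2)" "E = e (int n - 1)" "N = (of_nat n :: complex)"
  note defs = this
  have d: "d (2 * int n) = D + 2 * a" "d (2 * int n - 1) = D + a" "d (2 * int n - 3) = D - a"
    "d (int n - 2) = D - N * a"
    by (simp_all add: defs dcoef_def algebra_simps)
  have e: "e (int n) = E + b" "e (int n - 2) = E - b"
    by (simp_all add: defs ecoef_def algebra_simps)
  have shift: "2 * int (Suc n) - 2 = 2 * int n" "2 * int (Suc n) - 3 = 2 * int n - 1"
    "int (Suc n) - 1 = int n" "int (Suc n) - 2 = int n - 1"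
    "complex_of_nat (Suc n) = N + 1" "complex_of_nat (Suc n - 1) = N" "complex_of_nat (n - 1) = N - 1"
    using assms by (simp_all add: defs(6))
  have nz: "D \<noteq> 0" "D + 2 * a \<noteq> 0" "D + a \<noteq> 0"
    using assms d_nonzero[of "2 * int n - 2"] d_nonzero[of "2 * int n"] d_nonzero[of "2 * int n - 1"]
    unfolding d by (simp_all add: defs(4))
  have s: "D * sub1 n = N * E" "(D + 2 * a) * sub1 (Suc n) = (N + 1) * (E + b)"
    using d_times_sub1[of n] d_times_sub1[of "Suc n"]
    unfolding shift d e defs(4-6)[symmetric] by simp_all
  have g: "2 * (D - a) * sub2 n = (N - 1) * ((E - b) * sub1 n + N * c)"
    "2 * (D + a) * sub2 (Suc n) = N * (E * sub1 (Suc n) + (N + 1) * c)"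
    using d_times_sub2[of n] d_times_sub2[of "Suc n"] assms
    unfolding shift d e defs(3-6)[symmetric] by simp_all
  have gam: "\<gamma> n = sub2 n - sub2 (Suc n) - (sub1 n - sub1 (Suc n)) * sub1 n"
    using gamma_eq_sub2[OF assms] by (simp add: beta_eq_sub1)
  have s': "sub1 n = N * E / D" "sub1 (Suc n) = (N + 1) * (E + b) / (D + 2 * a)"
    using s nz by (simp_all add: field_simps)
  have g': "sub2 (Suc n) = N * (E * sub1 (Suc n) + (N + 1) * c) / (2 * (D + a))"
    using g(2) nz(3) by (metis nonzero_mult_div_cancel_left mult_eq_0_iff zero_neq_numeral)
  have phi: "poly \<phi> (- E / D) = (a * E^2 - b * E * D + c * D^2) / D^2"
    using nz unfolding poly_phi defs(1-3)[symmetric] by (simp add: field_simps power2_eq_square)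
  show ?thesis
  proof (cases "n = 1")
    \<comment> \<open>Here \<open>d (2 * int n - 3)\<close> is d(-1), which may vanish; instead of
      dividing by it, the value \<open>sub2 n = 0\<close> is used.\<close>
    case True
    then have vals: "D = coeff \<psi> 1" "E = coeff \<psi> 0" "N = 1" "sub2 n = 0" "d 1 = D + a"
      by (simp_all add: defs dcoef_def ecoef_def sub2_def)
    have "\<gamma> n = - poly \<phi> (- E / D) / d 1"
      unfolding vals(5) gam g' vals(4) s' phi unfolding vals(3)
      using nz by (simp add: divide_simps) algebra
    then show ?thesis
      using True unfolding vals(1,2) by (simp add: gamma_formula_def)
  next
    case False
    with assms have nz': "D - a \<noteq> 0"
      using d_nonzero[of "2 * int n - 3"] unfolding d by simp
    then have g'': "sub2 n = (N - 1) * ((E - b) * sub1 n + N * c) / (2 * (D - a))"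
      using g(1) by (metis nonzero_mult_div_cancel_left mult_eq_0_iff zero_neq_numeral)
    have "\<gamma> n = - (N * (D - N * a) / ((D - a) * (D + a))) * poly \<phi> (- E / D)"
      unfolding gam g' g'' s' phi
      using nz nz' by (simp add: divide_simps) algebra
    then show ?thesis
      using False by (simp only: gamma_formula_def Let_def if_False d flip: defs(4-6))
  qed
qed

text \<open>A second difference of \<open>d_times_sub1\<close>. In the proof of (C7) it makes two
  linear factors add up to \<phi>' - \<psi>.\<close>

lemma beta_difference:
  assumes "n \<ge> 1"
  shows "d (2 * int n) * \<beta> n - d (2 * int n - 4) * \<beta> (n - 1) = - 2 * coeff \<phi> 1"
proof -
  obtain m where n: "n = Suc m" using assms by (cases n) auto
  have "d (2 * int n) * \<beta> n - d (2 * int n - 4) * \<beta> (n - 1) =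
    2 * (d (2 * int (Suc m) - 2) * sub1 (Suc m)) - d (2 * int (Suc n) - 2) * sub1 (Suc n)
    - d (2 * int m - 2) * sub1 m"
    by (simp add: beta_eq_sub1 n dcoef_def algebra_simps)
  also have "\<dots> = - 2 * coeff \<phi> 1"
    unfolding d_times_sub1 by (simp add: n ecoef_def algebra_simps)
  finally show ?thesis .
qed

end

section \<open>Uniqueness of parameters; (C2), (C5) and (C8) imply (C1)\<close>

context monic_ops
begin

lemma C2_with_unique:
  assumes "C2_with P \<phi> a b c" "C2_with P \<phi> a' b' c'"
  shows "a n = a' n" "b n = b' n" "n \<ge> 1 \<Longrightarrow> c n = c' n"
proof -
  have eq: "smult (a n) (P (Suc n)) + smult (b n) (P n) + smult (c n) (prev P n) =
      smult (a' n) (P (Suc n)) + smult (b' n) (P n) + smult (c' n) (prev P n)"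
    using assms by (metis C2_with_def Suc_eq_plus1)
  show "a n = a' n" "b n = b' n" "n \<ge> 1 \<Longrightarrow> c n = c' n"
    using three_term_unique[OF eq] by blast+
qed

text \<open>Once f is cancelled, degree 2n + 2 sees only the square of \<open>P (Suc n)\<close>.
  This determines h, and then t.\<close>

lemma square_combination_unique:
  assumes "smult h ((P (Suc n))\<^sup>2) + f + smult t ((P n)\<^sup>2) =
      smult h' ((P (Suc n))\<^sup>2) + f + smult t' ((P n)\<^sup>2)"
  shows "h = h'" "t = t'"
proof -
  have "coeff ((P m)\<^sup>2) (2 * k) = (if k = m then 1 else 0)" if "k \<ge> m" for m k
    using that lead_coeff_power[of "P m" 2] degree_power_eq[of "P m" 2] coeff_eq_0[of "(P m)\<^sup>2" "2 * k"]
    by (auto simp: mult.commute)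
  from this[of "Suc n" "Suc n"] this[of n "Suc n"] show h: "h = h'"
    using arg_cong[OF assms, of "\<lambda>p. coeff p (2 * Suc n)"] by simp
  from assms have "smult (t - t') ((P n)\<^sup>2) = 0"
    unfolding h by (simp add: smult_diff_left)
  then show "t = t'" by simp
qed

lemma is_functional_pearson: "is_functional (\<lambda>f. u (\<phi> * pderiv f + \<psi> * f))"
  by (simp add: is_functional_iff pderiv_add pderiv_smult u_simps algebra_simps)

lemma pearson_if_basis:
  assumes "\<And>n. u (\<phi> * pderiv (P n) + \<psi> * P n) = 0"
  shows "fderiv (pmult \<phi> u) = pmult \<psi> u"
  using linear_condition_extend[OF is_functional_pearson assms]
  by (simp add: fderiv_pmult_eq_iff[OF functional])

text \<open>The two polynomials vanish together: if \<psi> = 0, then \<phi> u annihilates all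
  derivatives, hence everything, and regularity forces \<phi> = 0. The other direction is immediate
  from regularity.\<close>

lemma C1_forI:
  assumes "degree \<phi> \<le> 2" "degree \<psi> \<le> 1" "fderiv (pmult \<phi> u) = pmult \<psi> u" "\<phi> \<noteq> 0 \<or> \<psi> \<noteq> 0"
  shows "C1_for u \<phi> \<psi>"
proof -
  have D: "u (\<phi> * pderiv f + \<psi> * f) = 0" for f
    using assms(3) by (simp add: fderiv_pmult_eq_iff[OF functional])
  have "\<phi> = 0" if "\<psi> = 0"
  proof (rule zero_if_orthogonal)
    fix f
    show "u (\<phi> * f) = 0"
      using functional_eq_0_if_pderiv[OF is_functional_pmult[OF functional, of \<phi>], of f] D that
      by (simp add: pmult_def)
  qed
  moreover have "\<psi> = 0" if "\<phi> = 0"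
    using D that by (intro zero_if_orthogonal) simp
  ultimately show ?thesis
    using assms unfolding C1_for_def by blast
qed

lemma classicalI:
  assumes "C1_for u \<phi> \<psi>"
  shows "classical u P \<phi> \<psi>"
  using assms by unfold_locales (auto simp: C1_for_def)

text \<open>Paired with 1, the structure relation leaves a nonzero value only at n = 1, so D(\<phi>
  u) acts on the basis as a multiple of \<open>P 1\<close> times u.\<close>

lemma C1_if_C2:
  assumes "C2 P"
  shows "C1 u"
proof -
  obtain \<phi> a b c where "degree \<phi> \<le> 2" and c: "\<And>n. n \<ge> 1 \<Longrightarrow> c n \<noteq> 0"
    and eq: "\<And>n. \<phi> * pderiv (P n) = smult (a n) (P (Suc n)) + smult (b n) (P n) + smult (c n) (prev P n)"
    using assms by (auto simp: C2_def C2_with_def)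
  \<comment> \<open>The factor is forced by the pairing with \<open>P 1\<close>, where it has to
    cancel \<open>c 1 * \<kappa> 0\<close>.\<close>
  define \<psi> where "\<psi> = smult (- c 1 * \<kappa> 0 / \<kappa> 1) (P 1)"
  have *: "u (\<phi> * pderiv (P n)) = (if n = 1 then c 1 * \<kappa> 0 else 0)" for n
  proof (cases n)
    case (Suc m)
    then show ?thesis
      using u_P_combination[of "a n" n "b n" "c n" 0] by (simp add: eq)
  qed (simp add: u_simps)
  have "fderiv (pmult \<phi> u) = pmult \<psi> u"
    by (rule pearson_if_basis) (simp add: u_simps * \<psi>_def u_P_P)
  moreover have "\<phi> \<noteq> 0"
    using *[of 1] c[of 1] by (auto simp: u_simps)
  moreover have "degree \<psi> \<le> 1"
    by (simp add: \<psi>_def)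
  ultimately show ?thesis
    using C1_forI[of \<phi> \<psi>] \<open>degree \<phi> \<le> 2\<close> unfolding C1_def by blast
qed

text \<open>The equations for n = 1 and n = 2 bound the degrees of \<psi> and \<phi>. Pairing the
  equations with 1 gives the Pearson condition on the derivatives of the \<open>P n\<close>, which
  span all polynomials.\<close>

lemma C1_if_C5:
  assumes "C5 P"
  shows "C1 u"
proof -
  obtain \<phi> \<psi> l where l: "\<And>n. n \<ge> 1 \<Longrightarrow> l n \<noteq> 0"
    and eq: "\<And>n. \<phi> * pderiv (pderiv (P n)) + \<psi> * pderiv (P n) + smult (l n) (P n) = 0"
    using assms by (auto simp: C5_def C5_with_def)
  have pderiv_P1: "pderiv (P 1) = 1"
    using pderiv_P[of 0] monic_graded.P_0[OF monic_graded_nderiv] by simp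
  have psi: "\<psi> = smult (- l 1) (P 1)"
    using eq[of 1] by (simp add: pderiv_P1[simplified] eq_neg_iff_add_eq_0)
  have "\<phi> * [:2:] = - \<psi> * pderiv (P 2) - smult (l 2) (P 2)"
  proof -
    have "pderiv (pderiv (P 2)) = [:2:]"
      using coeff_P[of 2]
      by (simp add: poly_eq_iff coeff_pderiv coeff_pCons coeff_eq_0 eval_nat_numeral split: nat.splits)
    then show ?thesis using eq[of 2] by (simp add: algebra_simps eq_neg_iff_add_eq_0)
  qed
  moreover have "degree (- \<psi> * pderiv (P 2) - smult (l 2) (P 2)) \<le> 2"
  proof (rule degree_diff_le)
    have "degree (\<psi> * pderiv (P 2)) \<le> degree \<psi> + degree (pderiv (P 2))"
      by (rule degree_mult_le)
    also have "degree \<psi> \<le> 1" by (simp add: psi)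
    finally show "degree (- \<psi> * pderiv (P 2)) \<le> 2" by (simp add: degree_pderiv)
  qed simp
  ultimately have "degree (\<phi> * [:2:]) \<le> 2" by simp
  then have "degree \<phi> \<le> 2" by (simp add: mult.commute[of \<phi>])
  have "u (\<phi> * pderiv (pderiv (P (Suc n))) + \<psi> * pderiv (P (Suc n))) = 0" for n
    using eq[of "Suc n"] u_P_times_eq_0(1)[of 1 "Suc n"] by (simp add: u_simps eq_neg_iff_add_eq_0[symmetric])
  then have D: "fderiv (pmult \<phi> u) = pmult \<psi> u"
    using functional_eq_0_if_pderiv[OF is_functional_pearson, of \<phi> \<psi>]
    by (simp add: fderiv_pmult_eq_iff[OF functional])
  have "\<psi> \<noteq> 0" using l[of 1] by (simp add: psi)
  moreover have "degree \<psi> \<le> 1" by (simp add: psi)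
  ultimately show ?thesis
    using \<open>degree \<phi> \<le> 2\<close> D C1_forI[of \<phi> \<psi>] unfolding C1_def by blast
qed

text \<open>The Rodrigues formula for n = 1 is already a Pearson equation, with \<psi> a multiple of
  \<open>P 1\<close>.\<close>

lemma C1_if_C8:
  assumes "C8 u P"
  shows "C1 u"
proof -
  obtain \<phi> k where deg: "degree \<phi> \<le> 2" and k: "k 1 \<noteq> 0"
    and eq: "pmult (P 1) u = fscale (k 1) (fderiv (pmult \<phi> u))"
  proof -
    obtain \<phi> k where "C8_with u P \<phi> k" using assms by (auto simp: C8_def)
    then have "degree \<phi> \<le> 2" "k 1 \<noteq> 0"
      "pmult (P 1) u = fscale (k 1) ((fderiv ^^ 1) (pmult (\<phi> ^ 1) u))"
      unfolding C8_with_def by blast+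
    with that show thesis by simp
  qed
  define \<psi> where "\<psi> = smult (1 / k 1) (P 1)"
  have D: "fderiv (pmult \<phi> u) = pmult \<psi> u"
  proof
    fix f
    show "fderiv (pmult \<phi> u) f = pmult \<psi> u f"
      using fun_cong[OF eq, of f] k by (simp add: \<psi>_def pmult_def fscale_def u_simps)
  qed
  have "\<psi> \<noteq> 0" using k by (simp add: \<psi>_def)
  moreover have "degree \<psi> \<le> 1" by (simp add: \<psi>_def)
  ultimately show ?thesis
    using deg D C1_forI[of \<phi> \<psi>] unfolding C1_def by blast
qed

end

section \<open>Admissibility in terms of the numbers d_n\<close>

lemma admissible_iff:
  "admissible \<phi> \<psi> \<longleftrightarrow> degree \<phi> \<le> 2 \<and> degree \<psi> \<le> 1 \<and> (\<forall>n::nat. dcoef \<phi> \<psi> (int n) \<noteq> 0)"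
proof -
  have "pderiv \<psi> + smult (of_nat n / 2) (pderiv (pderiv \<phi>)) = [:dcoef \<phi> \<psi> (int n):]"
    if "degree \<phi> \<le> 2" "degree \<psi> \<le> 1" for n :: nat
    by (subst quadratic_pCons[OF that(1)], subst linear_pCons[OF that(2)])
       (simp add: dcoef_def pderiv_pCons)
  then show ?thesis by (auto simp: admissible_def)
qed

lemma (in monic_ops) C1_for_iff_C1'_for: "C1_for u \<phi> \<psi> \<longleftrightarrow> C1'_for u \<phi> \<psi>"
proof
  assume "C1_for u \<phi> \<psi>"
  then interpret classical u P \<phi> \<psi> by (rule classicalI)
  show "C1'_for u \<phi> \<psi>"
    using degree_phi degree_psi pearson by (simp add: C1'_for_def admissible_iff d_nonzero)
next
  assume C1': "C1'_for u \<phi> \<psi>"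
  then have D: "fderiv (pmult \<phi> u) = pmult \<psi> u" by (simp add: C1'_for_def)
  have "dcoef \<phi> \<psi> (int 0) \<noteq> 0" using C1' unfolding C1'_for_def admissible_iff by blast
  then have "\<psi> \<noteq> 0" by (auto simp: dcoef_def)
  then show "C1_for u \<phi> \<psi>"
    using C1' D by (intro C1_forI) (simp_all add: C1'_for_def admissible_iff)
qed

lemma (in monic_graded) monic_expansion_unique:
  assumes "n \<ge> 2" "f + smult r (P (n - 1)) + smult s (P (n - 2)) =
      f + smult r' (P (n - 1)) + smult s' (P (n - 2))"
  shows "r = r'" "s = s'"
proof -
  have eq: "smult r (P (n - 1)) + smult s (P (n - 2)) = smult r' (P (n - 1)) + smult s' (P (n - 2))"
    using assms(2) by (simp add: add.assoc)
  have "coeff (P (n - 2)) (n - 1) = 0" using \<open>n \<ge> 2\<close> by (intro coeff_eq_0) simp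
  then show "r = r'" using arg_cong[OF eq, of "\<lambda>p. coeff p (n - 1)"] coeff_P[of "n - 1"] by simp
  with eq have "smult (s - s') (P (n - 2)) = 0" by (simp add: smult_diff_left)
  then show "s = s'" by simp
qed

lemma (in monic_ops) linear_times_P:
  "[:x, y:] * P n = smult y (P (Suc n)) + smult (x + y * \<beta> n) (P n) + smult (y * \<gamma> n) (prev P n)"
proof -
  have "[:x, y:] * P n = smult x (P n) + smult y (pCons 0 (P n))" by simp
  then show ?thesis unfolding pCons_P by (simp add: smult_add_right smult_add_left algebra_simps)
qed

section \<open>Parameters in (C2), (C5), (C4) for k = 1, and (C7)\<close>

context classical
begin

lemma C2_with_structure: "C2_with P \<phi> (\<lambda>n. of_nat n * coeff \<phi> 2) (\<lambda>n. - (1/2) * poly \<psi> (\<beta> n))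
    (\<lambda>n. - d (int n - 1) * \<gamma> n)"
  unfolding C2_with_def Suc_eq_plus1[symmetric]
  using degree_phi structure_relation by (simp add: d_nonzero)

lemma C5_with_ode: "C5_with P \<phi> \<psi> (\<lambda>n. - of_nat n * d (int n - 1))"
  by (simp add: C5_with_def ode d_nonzero)

lemma C5_with_unique:
  assumes "C5_with P \<phi> \<psi> l"
  shows "l n = - of_nat n * d (int n - 1)"
proof -
  have "smult (of_nat n * d (int n - 1) + l n) (P n) = 0"
    using assms unfolding C5_with_def ode by (simp add: smult_add_left)
  then show ?thesis by (simp add: add_eq_0_iff2)
qed

text \<open>Differentiate the structure relation, then eliminate the second derivative by the
  differential equation and x times the first derivative by the differentiated recurrence. What
  remains is solved for \<open>P n\<close>.\<close>

lemma C4_with_1: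
  "C4_with P 1 (\<lambda>n. poly \<psi> (\<beta> n) / (2 * d (int n - 1)))
    (\<lambda>n. - ((of_nat n - 1) * coeff \<phi> 2 / d (int n - 2)) * \<gamma> n)"
  unfolding C4_with_def
proof (intro allI impI)
  fix n :: nat assume n: "n \<ge> 2"
  define a b p q N l where "a = coeff \<phi> 2" "b = coeff \<phi> 1" "p = coeff \<psi> 1" "q = coeff \<psi> 0"
    "N = (of_nat n :: complex)" "l = N * d (int n - 1)"
  note defs = this
  define B C where "B = - (1/2) * poly \<psi> (\<beta> n)" "C = - d (int n - 1) * \<gamma> n"
  let ?Q = "nderiv P 1"
  have dP: "pderiv (P (Suc n)) = smult (N + 1) (?Q n)" "pderiv (P n) = smult N (?Q (n - 1))"
    "pderiv (P (n - 1)) = smult (N - 1) (?Q (n - 2))"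
    using pderiv_P[of n] pderiv_P[of "n - 1"] pderiv_P[of "n - 2"] n
    by (auto simp: defs Suc_diff_Suc numeral_2_eq_2 of_nat_diff algebra_simps)
  have "pderiv (\<phi> * pderiv (P n)) = smult (N * a) (pderiv (P (Suc n))) + smult B (pderiv (P n)) +
      smult C (pderiv (P (n - 1)))"
    using n unfolding structure_relation by (simp add: pderiv_add pderiv_diff pderiv_smult prev_def defs B_C_def)
  moreover have "pderiv (\<phi> * pderiv (P n)) = (pderiv \<phi> - \<psi>) * pderiv (P n) + smult l (P n)"
    using ode[of n] by (simp add: pderiv_mult defs algebra_simps)
  moreover have "(pderiv \<phi> - \<psi>) * pderiv (P n) =
      smult (2 * a - p) (pCons 0 (pderiv (P n))) + smult (b - q) (pderiv (P n))"
  proof -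
    have "pderiv \<phi> - \<psi> = [:b - q, 2 * a - p:]"
      by (subst phi_eq, subst psi_eq) (simp add: defs pderiv_pCons)
    then show ?thesis by (simp add: algebra_simps)
  qed
  moreover have "pCons 0 (pderiv (P n)) =
      pderiv (P (Suc n)) + smult (\<beta> n) (pderiv (P n)) + smult (\<gamma> n) (pderiv (P (n - 1))) - P n"
    using arg_cong[OF pCons_P[of n], of pderiv] n
    by (simp add: pderiv_pCons pderiv_add pderiv_smult prev_def algebra_simps)
  ultimately have eq: "smult (2 * a - p) (smult (N + 1) (?Q n) + smult (\<beta> n) (smult N (?Q (n - 1))) +
      smult (\<gamma> n) (smult (N - 1) (?Q (n - 2))) - P n) + smult (b - q) (smult N (?Q (n - 1))) + smult l (P n) =
      smult (N * a) (smult (N + 1) (?Q n)) + smult B (smult N (?Q (n - 1))) + smult C (smult (N - 1) (?Q (n - 2)))"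
    by (simp only: dP)
  define r where "r = poly \<psi> (\<beta> n) / (2 * d (int n - 1))"
  define s where "s = - ((of_nat n - 1) * coeff \<phi> 2 / d (int n - 2)) * \<gamma> n"
  have d: "d (int n - 1) = (N - 1) * a + p" "d (int n - 2) = (N - 2) * a + p"
     "d (2 * int n) = 2 * N * a + p" "d (2 * int n - 2) = (2 * N - 2) * a + p" "d (-2) = p - 2 * a"
    by (simp_all add: defs dcoef_def algebra_simps)
  have nz: "(N - 1) * a + p \<noteq> 0" "(N - 2) * a + p \<noteq> 0"
    using n d_nonzero[of "int n - 1"] d_nonzero[of "int n - 2"] unfolding d by simp_all
  \<comment> \<open>The total coefficient of \<open>P n\<close> in \<open>eq\<close> is l - (2 a -
    p), which factors as this product.\<close>
  have nz': "(N + 1) * ((N - 2) * a + p) \<noteq> 0"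
    using nz(2) of_nat_neq_0[of n, where ?'a = complex] by (simp add: defs add.commute)
  have r: "2 * ((N - 1) * a + p) * r = p * \<beta> n + q"
    using nz(1) unfolding r_def d poly_psi defs(3,4)[symmetric]
    by (metis mult_eq_0_iff nonzero_mult_div_cancel_left times_divide_eq_right zero_neq_numeral)
  have s: "((N - 2) * a + p) * s = - ((N - 1) * a) * \<gamma> n"
    using nz unfolding s_def d defs(1,5)[symmetric] by simp
  have beta: "(2 * N * a + p) * ((2 * N - 2) * a + p) * \<beta> n =
      - ((p - 2 * a) * q + 2 * b * N * ((N - 1) * a + p))"
    using d_d_beta[of n] n unfolding d defs(1-5)[symmetric] by simp
  have B: "2 * B = - (p * \<beta> n + q)" and C: "C = - ((N - 1) * a + p) * \<gamma> n"
    unfolding B_C_def poly_psi d defs(3,4)[symmetric] by (simp_all add: field_simps)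
  \<comment> \<open>The coefficient of \<open>?Q (n - 1)\<close> in \<open>eq\<close> has to equal
    this product times r; here the closed form of \<open>\<beta> n\<close> enters.\<close>
  have r': "(N + 1) * ((N - 2) * a + p) * r = N * (B - (2 * a - p) * \<beta> n - (b - q))"
  proof -
    have "2 * ((N - 1) * a + p) * ((N + 1) * ((N - 2) * a + p) * r) =
      2 * ((N - 1) * a + p) * (N * (B - (2 * a - p) * \<beta> n - (b - q)))"
      using r beta B by algebra
    then show ?thesis using nz(1) by (metis mult_left_cancel mult_eq_0_iff zero_neq_numeral)
  qed
  have s': "(N + 1) * ((N - 2) * a + p) * s = (N - 1) * (C - (2 * a - p) * \<gamma> n)"
    using s C by algebra
  have "P n = ?Q n + smult r (?Q (n - 1)) + smult s (?Q (n - 2))"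
  proof (rule poly_eqI)
    fix k
    have "(N + 1) * ((N - 2) * a + p) * coeff (P n) k =
      (N + 1) * ((N - 2) * a + p) * coeff (?Q n + smult r (?Q (n - 1)) + smult s (?Q (n - 2))) k"
      using arg_cong[OF eq, of "\<lambda>f. coeff f k"] r' s'
      unfolding coeff_add coeff_diff coeff_smult defs(6) d by algebra
    then show "coeff (P n) k = coeff (?Q n + smult r (?Q (n - 1)) + smult s (?Q (n - 2))) k"
      using nz' by simp
  qed
  then show "nderiv P (1 - 1) n = ?Q n + smult r (?Q (n - 1)) + smult s (?Q (n - 2))"
    by (simp add: nderiv_0)
qed

lemma C7_with_classical: "C7_with P \<phi> \<psi> (\<lambda>n. d (2 * int n - 3)) (\<lambda>n. - d (2 * int n - 1) * \<gamma> n)"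
  unfolding C7_with_def
proof (intro conjI allI impI)
  show "admissible \<phi> \<psi>"
    using degree_phi degree_psi by (simp add: admissible_iff d_nonzero)
  fix n :: nat assume "n \<ge> 1"
  then obtain m where n: "n = Suc m" by (cases n) auto
  define a b p q where "a = coeff \<phi> 2" "b = coeff \<phi> 1" "p = coeff \<psi> 1" "q = coeff \<psi> 0"
  note defs = this
  \<comment> \<open>The recurrence trades the outer neighbours \<open>P (Suc n)\<close> and
    \<open>prev P m\<close> for linear factors, so that both derivatives are expressed by
    \<open>P n\<close> and \<open>P m\<close> alone.\<close>
  have 1: "\<phi> * pderiv (P n) = [:- (1/2) * poly \<psi> (\<beta> n) - of_nat n * a * \<beta> n, of_nat n * a:] * P n
      + smult (- d (2 * int n - 1) * \<gamma> n) (P m)"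
    unfolding structure_relation linear_times_P
    by (rule poly_eqI) (simp add: n prev_def defs dcoef_def algebra_simps)
  have 2: "\<phi> * pderiv (P m) = smult (d (2 * int n - 3)) (P n) +
      [:- (1/2) * poly \<psi> (\<beta> m) + d (int m - 1) * \<beta> m, - d (int m - 1):] * P m"
    unfolding structure_relation linear_times_P
    by (rule poly_eqI) (simp add: n defs dcoef_def algebra_simps)
  \<comment> \<open>In the product rule the linear factors of both relations multiply
    \<open>P n * P m\<close>, so only their sum matters.\<close>
  have "[:- (1/2) * poly \<psi> (\<beta> n) - of_nat n * a * \<beta> n, of_nat n * a:] +
     [:- (1/2) * poly \<psi> (\<beta> m) + d (int m - 1) * \<beta> m, - d (int m - 1):] = [:b - q, 2 * a - p:]"
    using beta_difference[of n] unfolding poly_psi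
    by (simp add: n defs dcoef_def) algebra
  also have "\<dots> = - (\<psi> - pderiv \<phi>)"
    by (subst psi_eq, subst phi_eq) (simp add: defs pderiv_pCons)
  finally have 3: "[:- (1/2) * poly \<psi> (\<beta> n) - of_nat n * a * \<beta> n, of_nat n * a:] =
      - (\<psi> - pderiv \<phi>) - [:- (1/2) * poly \<psi> (\<beta> m) + d (int m - 1) * \<beta> m, - d (int m - 1):]"
    by (simp add: eq_diff_eq)
  have "\<phi> * pderiv (P n * P m) = (\<phi> * pderiv (P n)) * P m + (\<phi> * pderiv (P m)) * P n"
    by (simp add: pderiv_mult algebra_simps)
  also have "\<dots> = smult (d (2 * int n - 3)) ((P n)\<^sup>2) - (\<psi> - pderiv \<phi>) * P n * P m +
      smult (- d (2 * int n - 1) * \<gamma> n) ((P m)\<^sup>2)"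
    unfolding 1 2 3 power2_eq_square by (simp only: algebra_simps mult_smult_left mult_smult_right minus_diff_eq)
  finally show "\<phi> * pderiv (P n * P (n - 1)) = smult (d (2 * int n - 3)) ((P n)\<^sup>2)
      - (\<psi> - pderiv \<phi>) * P n * P (n - 1) + smult (- d (2 * int n - 1) * \<gamma> n) ((P (n - 1))\<^sup>2)"
    by (simp add: n)
qed

lemma C7_with_unique:
  assumes "C7_with P \<phi> \<psi> h t" "n \<ge> 1"
  shows "h n = d (2 * int n - 3)" "t n = - d (2 * int n - 1) * \<gamma> n"
proof -
  obtain m where n: "n = Suc m" using assms(2) by (cases n) auto
  have "smult (h n) ((P (Suc m))\<^sup>2) + - ((\<psi> - pderiv \<phi>) * P n * P m) + smult (t n) ((P m)\<^sup>2) =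
    smult (d (2 * int n - 3)) ((P (Suc m))\<^sup>2) + - ((\<psi> - pderiv \<phi>) * P n * P m) +
    smult (- d (2 * int n - 1) * \<gamma> n) ((P m)\<^sup>2)"
    using assms C7_with_classical unfolding C7_with_def by (metis add_uminus_conv_diff diff_Suc_1 n)
  from square_combination_unique[OF this]
  show "h n = d (2 * int n - 3)" "t n = - d (2 * int n - 1) * \<gamma> n" .
qed

section \<open>The derived sequence and the Rodrigues formula\<close>

lemma classical_nderiv: "classical (pmult \<phi> u) (nderiv P 1) \<phi> (\<psi> + pderiv \<phi>)"
proof (intro classical.intro monic_ops.intro classical_axioms.intro)
  interpret Q: monic_graded "nderiv P 1" by (rule monic_graded_nderiv)
  show "is_functional (pmult \<phi> u)" by (rule is_functional_pmult[OF functional])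
  have eq: "pmult \<phi> u (nderiv P 1 m * nderiv P 1 n) =
      (if m = n then - d (int n) * \<kappa> (Suc n) / of_nat (Suc n) else 0)" for m n
  proof -
    \<comment> \<open>Integration by parts with the eigenfunction \<open>P (Suc m)\<close> turns the
      pairing of two derivatives under \<phi> u into a pairing of P under u; since d n is nonzero,
      so are the new norms.\<close>
    have "- (of_nat (Suc m) * d (int m) * u (P (Suc m) * P (Suc n))) =
        u (\<phi> * pderiv (P (Suc m)) * pderiv (P (Suc n)))"
      using u_L_times[of "P (Suc m)" "P (Suc n)"] by (simp add: L_P u_simps)
    also have "\<dots> = of_nat (Suc m) * of_nat (Suc n) * pmult \<phi> u (nderiv P 1 m * nderiv P 1 n)"
      by (simp only: pderiv_P mult_smult_left mult_smult_right u_simps pmult_def mult.assoc)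
         (simp add: algebra_simps)
    finally have "of_nat (Suc m) * (- d (int m) * u (P (Suc m) * P (Suc n))) =
        of_nat (Suc m) * (of_nat (Suc n) * pmult \<phi> u (nderiv P 1 m * nderiv P 1 n))"
      by (simp only: mult_minus_left mult_minus_right mult.assoc)
    then have "of_nat (Suc n) * pmult \<phi> u (nderiv P 1 m * nderiv P 1 n) =
        - d (int m) * u (P (Suc m) * P (Suc n))"
      using of_nat_neq_0[of m, where ?'a = complex] by (metis mult_left_cancel)
    then show ?thesis
      using of_nat_neq_0[of n, where ?'a = complex]
      by (auto simp: u_P_P field_simps simp del: of_nat_Suc)
  qed
  have "\<exists>k. (\<forall>n. k n \<noteq> 0) \<and>
      (\<forall>m n. pmult \<phi> u (nderiv P 1 m * nderiv P 1 n) = (if m = n then k n else 0))"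
    using d_of_nat_nonzero of_nat_neq_0[where ?'a = complex]
    by (intro exI[of _ "\<lambda>n. - d (int n) * \<kappa> (Suc n) / of_nat (Suc n)"] conjI allI eq)
       (simp del: of_nat_Suc)
  then show "monic_OP_wrt (pmult \<phi> u) (nderiv P 1)"
    by (simp add: monic_OP_wrt_def OP_wrt_def del: One_nat_def)
  show "\<phi> \<noteq> 0" "degree \<phi> \<le> 2" by (fact phi_nonzero degree_phi)+
  show "degree (\<psi> + pderiv \<phi>) \<le> 1"
    using degree_psi degree_phi by (intro degree_add_le) (simp_all add: degree_pderiv)
  \<comment> \<open>The Pearson equation of u tested on \<phi> f is the required one for \<phi> u
    tested on f.\<close>
  show "fderiv (pmult \<phi> (pmult \<phi> u)) = pmult (\<psi> + pderiv \<phi>) (pmult \<phi> u)"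
    unfolding fderiv_pmult_eq_iff[OF is_functional_pmult[OF functional]]
  proof
    fix f
    show "pmult \<phi> u (\<phi> * pderiv f + (\<psi> + pderiv \<phi>) * f) = 0"
      using u_pearson[of "\<phi> * f"] by (simp add: pmult_def pderiv_mult algebra_simps)
  qed
qed

end

lemma monic_OP_nderiv:
  assumes "classical u P \<phi> \<psi>"
  shows "monic_OP (nderiv P k)"
proof -
  have "\<exists>v \<psi>'. classical v (nderiv P k) \<phi> \<psi>'"
  proof (induction k)
    case 0
    then show ?case using assms by (metis nderiv_0)
  next
    case (Suc k)
    then show ?case by (metis classical.classical_nderiv nderiv_nderiv_1)
  qed
  then show ?thesis
    unfolding monic_OP_def using classical.axioms(1) monic_ops.functional monic_ops.ops by blast
qed

text \<open>The induction runs over all classical functionals at once: integrating by parts against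
  the eigenfunction \<open>P (Suc n)\<close> leads to the formula of index n for the derived
  sequence and \<phi> u.\<close>

lemma rodrigues:
  assumes "classical u P \<phi> \<psi>"
  shows "pmult (P n) u =
    fscale (\<Prod>i<n. inverse (dcoef \<phi> \<psi> (int n + int i - 1))) ((fderiv ^^ n) (pmult (\<phi> ^ n) u))"
  using assms
proof (induction n arbitrary: u P \<psi>)
  case 0
  then interpret classical u P \<phi> \<psi> .
  show ?case by (simp add: pmult_def fscale_def)
next
  case (Suc n)
  interpret classical u P \<phi> \<psi> by (rule Suc.prems)
  define k where "k = (\<Prod>i<n. inverse (dcoef \<phi> (\<psi> + pderiv \<phi>) (int n + int i - 1)))"
  have IH: "pmult (nderiv P 1 n) (pmult \<phi> u) =
      fscale k ((fderiv ^^ n) (pmult (\<phi> ^ n) (pmult \<phi> u)))"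
    unfolding k_def by (rule Suc.IH[OF classical_nderiv])
  \<comment> \<open>Passing from \<psi> to \<psi> + \<phi>' shifts the index of d by two, so the
    derived product is the original one without its first factor.\<close>
  have k: "(\<Prod>i<Suc n. inverse (d (int (Suc n) + int i - 1))) = inverse (d (int n)) * k"
    unfolding prod.lessThan_Suc_shift k_def
    by (auto intro!: prod.cong simp: dcoef_def coeff_pderiv numeral_2_eq_2 algebra_simps)
  have phi: "pmult (\<phi> ^ n) (pmult \<phi> u) = pmult (\<phi> ^ Suc n) u"
    by (simp add: pmult_def mult_ac)
  show ?case
  proof
    fix f
    have "of_nat (Suc n) * d (int n) * u (P (Suc n) * f) = u (L (P (Suc n)) * f)"
      by (simp add: L_P u_simps)
    also have "\<dots> = - (of_nat (Suc n) * pmult (nderiv P 1 n) (pmult \<phi> u) (pderiv f))"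
      unfolding u_L_times pderiv_P by (simp add: pmult_def u_simps mult.assoc del: of_nat_Suc)
    also have "\<dots> = of_nat (Suc n) * (k * (fderiv ^^ Suc n) (pmult (\<phi> ^ Suc n) u) f)"
      unfolding IH phi by (simp add: fscale_def fderiv_def)
    finally have "d (int n) * u (P (Suc n) * f) = k * (fderiv ^^ Suc n) (pmult (\<phi> ^ Suc n) u) f"
      using of_nat_neq_0[of n, where ?'a = complex] by (metis mult.assoc mult_left_cancel)
    then show "pmult (P (Suc n)) u f = fscale (\<Prod>i<Suc n. inverse (d (int (Suc n) + int i - 1)))
      ((fderiv ^^ Suc n) (pmult (\<phi> ^ Suc n) u)) f"
      unfolding k using d_nonzero[of "int n"] by (simp add: pmult_def fscale_def field_simps)
  qed
qed

context classical
begin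

lemma C8_with_rodrigues: "C8_with u P \<phi> (\<lambda>n. \<Prod>i<n. inverse (d (int n + int i - 1)))"
  using degree_phi rodrigues[OF classical_axioms] by (auto simp: C8_with_def d_nonzero)

lemma C8_with_unique:
  assumes "C8_with u P \<phi> k"
  shows "k n = (\<Prod>i<n. inverse (d (int n + int i - 1)))"
proof -
  let ?W = "(fderiv ^^ n) (pmult (\<phi> ^ n) u)"
  have "k n * ?W (P n) = \<kappa> n" "(\<Prod>i<n. inverse (d (int n + int i - 1))) * ?W (P n) = \<kappa> n"
    using assms C8_with_rodrigues unfolding C8_with_def by (metis pmult_def fscale_def \<kappa>_def)+
  then show ?thesis by (metis kappa_nonzero mult_cancel_right mult_zero_right)
qed

end

section \<open>Conditions on the moments\<close>

text \<open>The Pearson functional is tested on monomials. At n = 0 the truncated index n - 1 comes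
  with a zero factor.\<close>

lemma pearson_iff_moments:
  assumes "is_functional u" and deg: "degree \<phi> \<le> 2" "degree \<psi> \<le> 1"
  shows "fderiv (pmult \<phi> u) = pmult \<psi> u \<longleftrightarrow>
    (\<forall>n. dcoef \<phi> \<psi> (int n) * moment u (n + 1) + ecoef \<phi> \<psi> (int n) * moment u n +
      of_nat n * coeff \<phi> 0 * moment u (n - 1) = 0)"
proof -
  note u_simps = functional_simps[OF assms(1)]
  have graded: "monic_graded (monom (1::complex))"
    by unfold_locales (simp_all add: degree_monom_eq)
  have lin: "is_functional (\<lambda>f. u (\<phi> * pderiv f + \<psi> * f))"
    by (simp add: is_functional_iff pderiv_add pderiv_smult u_simps algebra_simps)
  have "u (\<phi> * pderiv (monom 1 n) + \<psi> * monom 1 n) = dcoef \<phi> \<psi> (int n) * moment u (n + 1) +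
      ecoef \<phi> \<psi> (int n) * moment u n + of_nat n * coeff \<phi> 0 * moment u (n - 1)" for n
  proof -
    have "\<phi> * pderiv (monom 1 n) + \<psi> * monom 1 n = smult (dcoef \<phi> \<psi> (int n)) (monom 1 (n + 1)) +
      smult (ecoef \<phi> \<psi> (int n)) (monom 1 n) + smult (of_nat n * coeff \<phi> 0) (monom 1 (n - 1))"
      by (subst (1 3) quadratic_pCons[OF deg(1)], subst linear_pCons[OF deg(2)])
         (cases n, simp_all add: pderiv_monom smult_monom dcoef_def ecoef_def poly_eq_iff coeff_pCons algebra_simps split: nat.splits)
    then show ?thesis by (simp add: u_simps moment_def)
  qed
  then show ?thesis
    using monic_graded.linear_condition_extend[OF graded lin]
    by (auto simp: fderiv_pmult_eq_iff[OF assms(1)])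
qed

text \<open>The series variable is w = 1/z, so multiplying by z shifts the coefficients down by one
  place.\<close>

lemma poly_in_z_quadratic_times:
  "fls_nth (poly_in_z [:c, b, a:] * F) n = c * fls_nth F n + b * fls_nth F (n + 1) + a * fls_nth F (n + 2)"
proof -
  have "poly_in_z [:c, b, a:] * F = fls_const c * F + fls_X_inv * (fls_const b * F) +
      fls_X_inv * (fls_X_inv * (fls_const a * F))"
    by (simp add: poly_in_z_def map_poly_pCons algebra_simps)
  then show ?thesis by (simp add: fls_X_inv_times_conv_shift(1) add.assoc)
qed

text \<open>The coefficient of w^(n+1) in the Stieltjes equation is the n-th moment
  relation.\<close>

lemma stieltjes_equation_iff_moments:
  assumes deg: "degree \<phi> \<le> 2" "degree \<psi> \<le> 1"
  shows "poly_in_z \<phi> * deriv_z (stieltjes u) =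
       poly_in_z (\<psi> - pderiv \<phi>) * stieltjes u +
       poly_in_z (pderiv \<psi> - smult (1 / 2) (pderiv (pderiv \<phi>))) * fls_const (moment u 0) \<longleftrightarrow>
    (\<forall>n. dcoef \<phi> \<psi> (int n) * moment u (n + 1) + ecoef \<phi> \<psi> (int n) * moment u n +
      of_nat n * coeff \<phi> 0 * moment u (n - 1) = 0)" (is "?lhs = ?rhs \<longleftrightarrow> ?moments")
proof -
  define a b c p q where "a = coeff \<phi> 2" "b = coeff \<phi> 1" "c = coeff \<phi> 0" "p = coeff \<psi> 1" "q = coeff \<psi> 0"
  note defs = this
  have phi: "\<phi> = [:c, b, a:]" and psi: "\<psi> = [:q, p:]"
    using quadratic_pCons[OF deg(1)] linear_pCons[OF deg(2)] by (simp_all add: defs)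
  have S: "fls_nth (stieltjes u) n = (if n \<ge> 1 then - moment u (nat (n - 1)) else 0)" for n
    by (simp add: stieltjes_def fls_X_times_conv_shift)
  have S': "fls_nth (deriv_z (stieltjes u)) n = (if n \<ge> 2 then of_int (n - 1) * moment u (nat (n - 2)) else 0)" for n
    by (simp add: deriv_z_def fls_X_power_times_conv_shift S algebra_simps)
  have lhs: "fls_nth ?lhs n = c * fls_nth (deriv_z (stieltjes u)) n + b * fls_nth (deriv_z (stieltjes u)) (n + 1)
      + a * fls_nth (deriv_z (stieltjes u)) (n + 2)" for n
    unfolding phi by (rule poly_in_z_quadratic_times)
  have 1: "\<psi> - pderiv \<phi> = [:q - b, p - 2 * a, 0:]"
    by (simp add: phi psi pderiv_pCons)
  have 2: "pderiv \<psi> - smult (1 / 2) (pderiv (pderiv \<phi>)) = [:p - a, 0, 0:]"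
    by (simp add: phi psi pderiv_pCons)
  have rhs: "fls_nth ?rhs n = (q - b) * fls_nth (stieltjes u) n + (p - 2 * a) * fls_nth (stieltjes u) (n + 1) +
      (p - a) * (if n = 0 then moment u 0 else 0)" for n
    unfolding 1 2 fls_plus_nth poly_in_z_quadratic_times by simp
  \<comment> \<open>The coefficients of nonpositive powers of w agree identically; at w^0 the term
    (\<psi>' - \<phi>''/2) u_0 provides the balance.\<close>
  have small: "fls_nth ?lhs n = fls_nth ?rhs n" if "n \<le> 0" for n
    unfolding lhs rhs S S' using that by (cases "n = 0") (auto simp: algebra_simps)
  have large: "fls_nth ?lhs (int n + 1) = fls_nth ?rhs (int n + 1) \<longleftrightarrow>
    dcoef \<phi> \<psi> (int n) * moment u (n + 1) + ecoef \<phi> \<psi> (int n) * moment u n + of_nat n * coeff \<phi> 0 * moment u (n - 1) = 0" for n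
  proof -
    have "fls_nth ?lhs (int n + 1) - fls_nth ?rhs (int n + 1) =
      dcoef \<phi> \<psi> (int n) * moment u (n + 1) + ecoef \<phi> \<psi> (int n) * moment u n + of_nat n * coeff \<phi> 0 * moment u (n - 1)"
      unfolding lhs rhs S S' dcoef_def ecoef_def defs[symmetric]
      by (cases n) (auto simp: nat_add_distrib algebra_simps)
    then show ?thesis by (metis eq_iff_diff_eq_0)
  qed
  show ?thesis
  proof
    assume "?lhs = ?rhs"
    then show ?moments using large by simp
  next
    assume m: ?moments
    show "?lhs = ?rhs"
    proof (rule fls_eqI)
      fix n
      show "fls_nth ?lhs n = fls_nth ?rhs n"
      proof (cases "n \<le> 0")
        case False
        then have "n = int (nat (n - 1)) + 1" by simp
        with m large show ?thesis by metis
      qed (rule small)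
    qed
  qed
qed

lemma C6_for_iff_C1'_for:
  assumes "is_functional u"
  shows "C6_for u \<phi> \<psi> \<longleftrightarrow> C1'_for u \<phi> \<psi>"
proof (cases "degree \<phi> \<le> 2 \<and> degree \<psi> \<le> 1")
  case True
  then show ?thesis
    unfolding C6_for_def C1'_for_def
    by (simp only: stieltjes_equation_iff_moments pearson_iff_moments[OF assms])
qed (auto simp: C6_for_def C1'_for_def admissible_def)

section \<open>From (C7) to (C1)\<close>

lemma coeff_mult_degree_le:
  fixes f g :: "'a::comm_semiring_0 poly"
  assumes "degree f \<le> i" "degree g \<le> j"
  shows "coeff (f * g) (i + j) = coeff f i * coeff g j"
proof -
  have "coeff (f * g) (i + j) = (\<Sum>k\<le>i + j. if k = i then coeff f i * coeff g j else 0)"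
    unfolding coeff_mult
  proof (intro sum.cong refl)
    fix k assume "k \<in> {..i + j}"
    then have "k < i \<Longrightarrow> j < i + j - k" by auto
    then show "coeff f k * coeff g (i + j - k) = (if k = i then coeff f i * coeff g j else 0)"
      using assms by (cases k i rule: linorder_cases) (auto simp: coeff_eq_0)
  qed
  then show ?thesis by simp
qed

context monic_ops
begin

text \<open>As \<open>P n\<close> and \<open>P (Suc n)\<close> are coprime, the relation (C7) with index \<open>Suc n\<close> splits
  into first-order structure relations.\<close>
lemma C1_if_C7:
  assumes "C7 P"
  shows "C1 u"
proof -
  obtain \<phi> \<psi> h t where adm: "admissible \<phi> \<psi>" and
    C7: "\<And>n. n \<ge> 1 \<Longrightarrow> \<phi> * pderiv (P n * P (n - 1)) =
        smult (h n) ((P n)\<^sup>2) - (\<psi> - pderiv \<phi>) * P n * P (n - 1) + smult (t n) ((P (n - 1))\<^sup>2)"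
    using assms unfolding C7_def C7_with_def by blast
  have deg: "degree \<phi> \<le> 2" "degree \<psi> \<le> 1" and d: "\<And>n. dcoef \<phi> \<psi> (int n) \<noteq> 0"
    using adm by (auto simp: admissible_iff)
  define W where "W = \<psi> - pderiv \<phi>"
  have degW: "degree W \<le> 1" and coeffW: "coeff W 1 = coeff \<psi> 1 - 2 * coeff \<phi> 2"
    using deg by (auto simp: W_def coeff_pderiv degree_pderiv numeral_2_eq_2 intro!: degree_diff_le)
  have eq: "\<phi> * pderiv (P n) * P (Suc n) + \<phi> * pderiv (P (Suc n)) * P n =
      smult (h (Suc n)) ((P (Suc n))\<^sup>2) - W * P (Suc n) * P n + smult (t (Suc n)) ((P n)\<^sup>2)" for n
    using C7[of "Suc n"] by (simp add: pderiv_mult W_def algebra_simps)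
  have degree_phi_dP: "degree (\<phi> * pderiv (P n)) \<le> Suc n" and
    coeff_phi_dP: "coeff (\<phi> * pderiv (P n)) (Suc n) = of_nat n * coeff \<phi> 2" for n
    using degree_quadratic_mult_pderiv[OF deg(1), of 0 "P n" n]
      coeff_quadratic_mult_pderiv[OF deg(1), of 0 "P n" n] by simp_all
  \<comment> \<open>Compares coefficients at degree 2n + 2, which the square of \<open>P n\<close>
    does not reach.\<close>
  have h: "h (Suc n) = dcoef \<phi> \<psi> (2 * int n - 1)" for n
  proof -
    have "coeff (\<phi> * pderiv (P n) * P (Suc n)) (Suc n + Suc n) = of_nat n * coeff \<phi> 2"
      "coeff ((P (Suc n))\<^sup>2) (Suc n + Suc n) = 1"
      "coeff (\<phi> * pderiv (P (Suc n)) * P n) (Suc (Suc n) + n) = of_nat (Suc n) * coeff \<phi> 2"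
      "coeff (W * P (Suc n) * P n) ((1 + Suc n) + n) = coeff W 1"
      using degree_phi_dP[of n] degree_phi_dP[of "Suc n"] degree_mult_le[of W "P (Suc n)"] degW
      by (simp_all add: coeff_mult_degree_le coeff_phi_dP power2_eq_square del: plus_nat.simps add_Suc_right)
    moreover have "coeff ((P n)\<^sup>2) (Suc n + Suc n) = 0"
      using degree_mult_le[of "P n" "P n"] by (intro coeff_eq_0) (simp add: power2_eq_square)
    ultimately have "h (Suc n) = coeff W 1 + (1 + 2 * of_nat n) * coeff \<phi> 2"
      using arg_cong[OF eq[of n], of "\<lambda>f. coeff f (Suc n + Suc n)"] by (simp add: algebra_simps)
    then show ?thesis unfolding coeffW by (simp add: dcoef_def algebra_simps)
  qed
  have "\<exists>B. \<phi> * pderiv (P n) = smult (h (Suc n)) (P (Suc n)) + B * P n" for n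
  proof -
    \<comment> \<open>Sorting \<open>eq\<close> into multiples of \<open>P (Suc n)\<close> and of
      \<open>P n\<close> lets coprimality extract a factor \<open>P n\<close>.\<close>
    have "(\<phi> * pderiv (P n) - smult (h (Suc n)) (P (Suc n))) * P (Suc n) =
      (- W * P (Suc n) + smult (t (Suc n)) (P n) - \<phi> * pderiv (P (Suc n))) * P n"
      using eq[of n] by (simp add: algebra_simps power2_eq_square)
    then have "P n dvd (\<phi> * pderiv (P n) - smult (h (Suc n)) (P (Suc n))) * P (Suc n)" by simp
    then have "P n dvd \<phi> * pderiv (P n) - smult (h (Suc n)) (P (Suc n))"
      by (rule dvd_if_dvd_mult_P_Suc)
    then show ?thesis by (metis dvd_def mult.commute diff_add_cancel add.commute)
  qed
  then obtain B where B: "\<And>n. \<phi> * pderiv (P n) = smult (h (Suc n)) (P (Suc n)) + B n * P n"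
    by metis
  have "\<exists>x y. B n = [:x, y:] \<and> y = - dcoef \<phi> \<psi> (int n - 1)" for n
  proof -
    have BP: "B n * P n = \<phi> * pderiv (P n) - smult (h (Suc n)) (P (Suc n))"
      using B[of n] by simp
    then have "degree (B n * P n) \<le> Suc n"
      using degree_phi_dP by (simp add: degree_diff_le)
    then have degB: "degree (B n) \<le> 1"
      by (cases "B n = 0") (simp_all add: degree_mult_eq)
    have "coeff (B n * P n) (Suc n) = of_nat n * coeff \<phi> 2 - h (Suc n)"
      unfolding BP by (simp add: coeff_phi_dP)
    moreover have "coeff (B n * P n) (1 + n) = coeff (B n) 1 * coeff (P n) n"
      using degB by (intro coeff_mult_degree_le) simp_all
    ultimately have "coeff (B n) 1 = - dcoef \<phi> \<psi> (int n - 1)"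
      by (simp add: h dcoef_def algebra_simps)
    with linear_pCons[OF degB] show ?thesis by blast
  qed
  then obtain x where x: "\<And>n. B n = [:x n, - dcoef \<phi> \<psi> (int n - 1):]" by metis
  \<comment> \<open>As \<open>B n\<close> is linear with known slope, the recurrence turns
    \<open>B n * P n\<close> into a three-term combination; admissibility keeps its last coefficient
    nonzero.\<close>
  have "C2_with P \<phi> (\<lambda>n. h (Suc n) - dcoef \<phi> \<psi> (int n - 1)) (\<lambda>n. x n - dcoef \<phi> \<psi> (int n - 1) * \<beta> n)
      (\<lambda>n. - dcoef \<phi> \<psi> (int n - 1) * \<gamma> n)"
    unfolding C2_with_def
  proof (intro conjI allI impI)
    fix n :: nat assume "n \<ge> 1"
    then show "- dcoef \<phi> \<psi> (int n - 1) * \<gamma> n \<noteq> 0"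
      using d[of "n - 1"] by (simp add: of_nat_diff)
  next
    fix n
    show "\<phi> * pderiv (P n) = smult (h (Suc n) - dcoef \<phi> \<psi> (int n - 1)) (P (n + 1)) +
        smult (x n - dcoef \<phi> \<psi> (int n - 1) * \<beta> n) (P n) +
        smult (- dcoef \<phi> \<psi> (int n - 1) * \<gamma> n) (prev P n)"
      unfolding B[of n] x linear_times_P by (rule poly_eqI) (simp add: algebra_simps)
  qed (rule deg)
  then show ?thesis using C1_if_C2 by (auto simp: C2_def)
qed

end

section \<open>Derivatives of orthogonal sequences\<close>

text \<open>The Leibniz rule for x f: only two terms survive because the second derivative of x
  vanishes.\<close>

lemma higher_pderiv_pCons_0:
  fixes f :: "complex poly"
  shows "(pderiv ^^ Suc k) (pCons 0 f) =
    pCons 0 ((pderiv ^^ Suc k) f) + smult (of_nat (Suc k)) ((pderiv ^^ k) f)"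
proof (induction k)
  case (Suc k)
  have "(pderiv ^^ Suc (Suc k)) (pCons 0 f) = pderiv ((pderiv ^^ Suc k) (pCons 0 f))" by simp
  also have "\<dots> = pCons 0 ((pderiv ^^ Suc (Suc k)) f) + smult (of_nat (Suc (Suc k))) ((pderiv ^^ Suc k) f)"
    unfolding Suc.IH by (rule poly_eqI) (simp add: pderiv_add pderiv_smult pderiv_pCons algebra_simps)
  finally show ?case .
qed (simp add: pderiv_pCons)

lemma coeff_eq_0_if_higher_pderiv_eq_0:
  fixes f :: "complex poly"
  assumes "(pderiv ^^ k) f = 0" "i \<ge> k"
  shows "coeff f i = 0"
proof -
  have "pochhammer (of_nat (Suc (i - k))) k * coeff f (i - k + k) = 0"
    using assms(1) coeff_higher_pderiv[of k f "i - k"] by simp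
  moreover have "pochhammer (of_nat (Suc (i - k))) k \<noteq> (0 :: complex)"
    by (rule pochhammer_of_nat_nonzero)
  ultimately show ?thesis using \<open>i \<ge> k\<close> by simp
qed

section \<open>From (C3) to (C4), and from (C4) to (C1)\<close>

context monic_ops
begin

text \<open>The derivative of order k + 1 of x \<open>P (n + k)\<close> is computed by the Leibniz
  rule and by the recurrence of P. This isolates \<open>nderiv P k n\<close> up to x times a member
  of the derived sequence, which the recurrence of that sequence removes.\<close>

lemma C4_with_if_monic_OP:
  assumes "monic_OP (nderiv P (Suc k))"
  shows "\<exists>r s. C4_with P (Suc k) r s"
proof -
  obtain v where v: "is_functional v" "monic_OP_wrt v (nderiv P (Suc k))"
    using assms by (auto simp: monic_OP_def)
  interpret Q: monic_ops v "nderiv P (Suc k)" by (rule monic_ops.intro[OF v])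
  interpret Q': monic_graded "nderiv P k" by (rule monic_graded_nderiv)
  let ?Q = "nderiv P (Suc k)" and ?D = "pderiv ^^ Suc k"
  have "\<exists>r s. nderiv P k n = ?Q n + smult r (?Q (n - 1)) + smult s (?Q (n - 2))" if "n \<ge> 2" for n
  proof -
    obtain i where n: "n = Suc (Suc i)" using le_Suc_ex[OF \<open>n \<ge> 2\<close>] by auto
    define w :: "nat \<Rightarrow> complex" where "w j = pochhammer (of_nat (j + 1)) (Suc k)" for j
    define w' :: complex where "w' = of_nat (Suc k) * pochhammer (of_nat (n + 1)) k"
    have D: "?D (P (j + Suc k)) = smult (w j) (?Q j)" for j
      unfolding w_def by (rule higher_pderiv_P)
    have Dn: "?D (P (Suc (n + k))) = smult (w n) (?Q n)"
      "?D (P (n + k)) = smult (w (Suc i)) (?Q (Suc i))" "?D (P (Suc (i + k))) = smult (w i) (?Q i)"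
      using D[of n] D[of "Suc i"] D[of i] by (simp_all add: n)
    have "?D (pCons 0 (P (n + k))) = pCons 0 (?D (P (n + k))) + smult w' (nderiv P k n)"
      unfolding higher_pderiv_pCons_0 by (simp add: higher_pderiv_P w'_def)
    moreover have "?D (pCons 0 (P (n + k))) =
        ?D (P (Suc (n + k))) + smult (\<beta> (n + k)) (?D (P (n + k))) + smult (\<gamma> (n + k)) (?D (P (Suc (i + k))))"
      unfolding pCons_P by (simp only: higher_pderiv_add higher_pderiv_smult) (simp add: prev_def n)
    ultimately have "smult w' (nderiv P k n) = smult (w n) (?Q n) +
        smult (\<beta> (n + k)) (smult (w (Suc i)) (?Q (Suc i))) + smult (\<gamma> (n + k)) (smult (w i) (?Q i)) -
        smult (w (Suc i)) (pCons 0 (?Q (Suc i)))"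
      unfolding Dn by (simp add: algebra_simps)
    also have "\<dots> = smult (w n - w (Suc i)) (?Q n) +
        smult (\<beta> (n + k) * w (Suc i) - w (Suc i) * Q.\<beta> (Suc i)) (?Q (n - 1)) +
        smult (\<gamma> (n + k) * w i - w (Suc i) * Q.\<gamma> (Suc i)) (?Q (n - 2))"
      unfolding Q.pCons_P by (rule poly_eqI) (simp add: n prev_def algebra_simps)
    finally have eq: "smult w' (nderiv P k n) = \<dots>" .
    have "w' \<noteq> 0"
      unfolding w'_def using pochhammer_of_nat_nonzero[of n k] by (simp add: of_nat_neq_0 del: of_nat_Suc)
    have "coeff (?Q (n - 1)) n = 0" "coeff (?Q (n - 2)) n = 0"
      using n by (auto intro!: coeff_eq_0)
    \<comment> \<open>Comparing leading coefficients shows that division by w' makes the coefficient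
      of \<open>?Q n\<close> equal to 1.\<close>
    then have w': "w' = w n - w (Suc i)"
      using arg_cong[OF eq, of "\<lambda>f. coeff f n"] by simp
    have "nderiv P k n = ?Q n +
        smult ((\<beta> (n + k) * w (Suc i) - w (Suc i) * Q.\<beta> (Suc i)) / w') (?Q (n - 1)) +
        smult ((\<gamma> (n + k) * w i - w (Suc i) * Q.\<gamma> (Suc i)) / w') (?Q (n - 2))"
    proof (rule poly_eqI)
      fix l
      show "coeff (nderiv P k n) l = coeff (?Q n +
        smult ((\<beta> (n + k) * w (Suc i) - w (Suc i) * Q.\<beta> (Suc i)) / w') (?Q (n - 1)) +
        smult ((\<gamma> (n + k) * w i - w (Suc i) * Q.\<gamma> (Suc i)) / w') (?Q (n - 2))) l"
        using arg_cong[OF eq, of "\<lambda>f. coeff f l"] \<open>w' \<noteq> 0\<close>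
        unfolding w'[symmetric] coeff_add coeff_smult by (simp add: divide_simps) (simp add: algebra_simps)
    qed
    then show ?thesis by blast
  qed
  then have "\<exists>rs. \<forall>n\<ge>2. nderiv P k n = ?Q n + smult (fst (rs n)) (?Q (n - 1)) + smult (snd (rs n)) (?Q (n - 2))"
    by (intro choice) (metis fst_conv snd_conv)
  then obtain rs where "\<forall>n\<ge>2. nderiv P k n = ?Q n + smult (fst (rs n)) (?Q (n - 1)) + smult (snd (rs n)) (?Q (n - 2))"
    by blast
  then show ?thesis
    unfolding C4_with_def by (intro exI[of _ "\<lambda>n. fst (rs n)"] exI[of _ "\<lambda>n. snd (rs n)"]) simp
qed

text \<open>Without normalizations, (C4) equates the k-th derivatives of \<open>P j\<close> and of
  the derivative of a three-term combination, so their difference has degree below k. Naming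
  coefficients instead of a degree also covers k = 0, where the difference is zero.\<close>

lemma C4_with_expansion:
  assumes C4: "C4_with P (Suc k) r s" and "j \<ge> k"
  shows "\<exists>A B C. A \<noteq> 0 \<and> (\<forall>i\<ge>k. coeff (P j -
      pderiv (smult A (P (Suc j)) + smult B (P j) + smult C (prev P j))) i = 0)"
proof -
  obtain n where j: "j = n + k" using \<open>j \<ge> k\<close> by (metis le_Suc_ex add.commute)
  let ?D = "pderiv ^^ Suc k"
  interpret Q: monic_graded "nderiv P (Suc k)" by (rule monic_graded_nderiv)
  interpret Q': monic_graded "nderiv P k" by (rule monic_graded_nderiv)
  define w :: "nat \<Rightarrow> complex" where "w i = 1 / pochhammer (of_nat (i + 1)) (Suc k)" for i
  have w: "w i \<noteq> 0" and Q: "nderiv P (Suc k) i = smult (w i) (?D (P (i + Suc k)))" for i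
    using pochhammer_of_nat_nonzero[of i "Suc k"] by (simp_all add: w_def nderiv_def del: funpow.simps)
  have "\<exists>x y z. x \<noteq> 0 \<and> nderiv P k n = smult x (?D (P (Suc j))) + smult y (?D (P j)) + smult z (?D (prev P j))"
  proof -
    \<comment> \<open>(C4) starts at n = 2. For n = 0 both sequences equal 1, and for n = 1 two
      monic polynomials differ by a constant.\<close>
    consider "n = 0" | "n = 1" | i where "n = Suc (Suc i)" by (metis One_nat_def not0_implies_Suc)
    then show ?thesis
    proof cases
      case 1
      then have "nderiv P k n = smult (w 0) (?D (P (Suc j)))"
        using Q[of 0] by (simp add: j)
      then show ?thesis using w[of 0] by (intro exI[of _ "w 0"] exI[of _ 0]) simp
    next
      case 2
      have "degree (nderiv P k 1 - nderiv P (Suc k) 1) \<le> 1"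
        using Q.degree_P[of 1] Q'.degree_P[of 1] by (intro degree_diff_le) simp_all
      moreover have "coeff (nderiv P k 1 - nderiv P (Suc k) 1) 1 = 0"
        using Q.coeff_P[of 1] Q'.coeff_P[of 1] by simp
      ultimately have "nderiv P k 1 - nderiv P (Suc k) 1 = [:coeff (nderiv P k 1 - nderiv P (Suc k) 1) 0:]"
        using linear_pCons by fastforce
      then obtain c where "nderiv P k 1 - nderiv P (Suc k) 1 = [:c:]" by blast
      then have "nderiv P k 1 = nderiv P (Suc k) 1 + smult c (nderiv P (Suc k) 0)"
        by (simp add: algebra_simps)
      then have "nderiv P k n = smult (w 1) (?D (P (Suc j))) + smult (c * w 0) (?D (P j))"
        unfolding Q 2 j by (simp del: funpow.simps)
      then show ?thesis using w[of 1] by (intro exI[of _ "w 1"] exI[of _ "c * w 0"] exI[of _ 0]) simp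
    next
      case 3
      then have "nderiv P k n = nderiv P (Suc k) n + smult (r n) (nderiv P (Suc k) (Suc i)) +
          smult (s n) (nderiv P (Suc k) i)"
        using C4 unfolding C4_with_def by simp
      then have "nderiv P k n = smult (w n) (?D (P (Suc j))) + smult (r n * w (Suc i)) (?D (P j)) +
          smult (s n * w i) (?D (prev P j))"
        using 3 Q[of n] Q[of "Suc i"] Q[of i] by (simp add: j prev_def del: funpow.simps)
      then show ?thesis using w[of n] by blast
    qed
  qed
  then obtain x y z where "x \<noteq> 0" and
    xyz: "nderiv P k n = smult x (?D (P (Suc j))) + smult y (?D (P j)) + smult z (?D (prev P j))" by blast
  define c :: complex where "c = pochhammer (of_nat (n + 1)) k"
  have "c \<noteq> 0" unfolding c_def using pochhammer_of_nat_nonzero[of n k] by simp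
  have "(pderiv ^^ k) (P j) = smult c (nderiv P k n)"
    unfolding c_def j by (rule higher_pderiv_P)
  also have "\<dots> = ?D (smult (c * x) (P (Suc j)) + smult (c * y) (P j) + smult (c * z) (prev P j))"
    unfolding xyz higher_pderiv_add higher_pderiv_smult by (simp add: smult_add_right)
  also have "\<dots> = (pderiv ^^ k) (pderiv (smult (c * x) (P (Suc j)) + smult (c * y) (P j) + smult (c * z) (prev P j)))"
    by (simp only: funpow_Suc_right o_apply)
  finally have "(pderiv ^^ k) (P j - pderiv (smult (c * x) (P (Suc j)) + smult (c * y) (P j) + smult (c * z) (prev P j))) = 0"
    using higher_pderiv_add[of k "pderiv (smult (c * x) (P (Suc j)) + smult (c * y) (P j) + smult (c * z) (prev P j))"
      "P j - pderiv (smult (c * x) (P (Suc j)) + smult (c * y) (P j) + smult (c * z) (prev P j))"] by simp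
  then have "\<forall>i\<ge>k. coeff (P j - pderiv (smult (c * x) (P (Suc j)) + smult (c * y) (P j) + smult (c * z) (prev P j))) i = 0"
    by (blast intro: coeff_eq_0_if_higher_pderiv_eq_0)
  moreover have "c * x \<noteq> 0" using \<open>c \<noteq> 0\<close> \<open>x \<noteq> 0\<close> by simp
  ultimately show ?thesis by blast
qed

text \<open>Since each \<open>P j\<close> with j \<ge> k is a derivative up to degrees below k, the
  equation D(q u) = \<open>P m\<close> u prescribes the pairings of q with these \<open>P j\<close>.
  They vanish unless j is m - 1, m or m + 1, which dictates \<open>q m\<close>. For m > k it
  annihilates the error terms.\<close>

lemma pearson_family_if_C4:
  assumes "C4_with P (Suc k) r s"
  obtains q x where "\<And>m. m > k \<Longrightarrow> x m \<noteq> 0" "\<And>m. m > k \<Longrightarrow> degree (q m) \<le> Suc m"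
    "\<And>m f. m > k \<Longrightarrow> degree f \<le> m - 1 \<Longrightarrow> u (q m * f) = x m * coeff f (m - 1)"
    "\<And>m. m > k \<Longrightarrow> fderiv (pmult (q m) u) = pmult (P m) u"
proof -
  obtain A B C where A: "\<And>j. j \<ge> k \<Longrightarrow> A j \<noteq> 0" and
    ABC: "\<And>j i. j \<ge> k \<Longrightarrow> i \<ge> k \<Longrightarrow> coeff (P j -
      pderiv (smult (A j) (P (Suc j)) + smult (B j) (P j) + smult (C j) (prev P j))) i = 0"
    using C4_with_expansion[OF assms] by metis
  define q where "q m = smult (- \<kappa> m) (smult (A (m - 1) / \<kappa> (m - 1)) (P (m - 1)) +
      smult (B m / \<kappa> m) (P m) + smult (C (Suc m) / \<kappa> (Suc m)) (P (Suc m)))" for m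
  define x where "x m = - \<kappa> m * A (m - 1)" for m
  have u_q_P: "u (q m * P j) = - \<kappa> m * (if Suc j = m then A j else if j = m then B j
      else if j = Suc m then C j else 0)" if "m > k" for m j
    using that by (auto simp: q_def distrib_right u_simps u_P_P)
  have u_q: "u (q m * f) = x m * coeff f (m - 1)" if "m > k" "degree f \<le> m - 1" for m f
    using that by (simp add: q_def x_def distrib_right u_simps u_P_times coeff_eq_0)
  \<comment> \<open>Strong induction on j: the error term drops out under \<open>q m\<close>, and
    \<open>A i \<noteq> 0\<close> allows solving for the derivative of
    \<open>P (Suc i)\<close>.\<close>
  have u_dP: "u (q m * pderiv (P j)) = (if j = m then - \<kappa> m else 0)" if "m > k" for m j
  proof (induction j rule: less_induct)
    case (less j)
    show ?case
    proof (cases "j \<le> k")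
      case True
      then have "u (q m * pderiv (P j)) = x m * coeff (pderiv (P j)) (m - 1)"
        using that by (intro u_q) (simp_all add: degree_pderiv)
      with True that show ?thesis by (simp add: coeff_pderiv coeff_eq_0)
    next
      case False
      then obtain i where j: "j = Suc i" and "i \<ge> k" by (cases j) auto
      define g where "g = P i - pderiv (smult (A i) (P (Suc i)) + smult (B i) (P i) + smult (C i) (prev P i))"
      have "degree g \<le> m - 1"
        using ABC[OF \<open>i \<ge> k\<close>] that by (intro degree_le) (auto simp: g_def)
      then have "u (q m * g) = 0"
        using ABC[OF \<open>i \<ge> k\<close>, of "m - 1"] that by (simp only: u_q[OF that] flip: g_def) simp
      then have "u (q m * P i) = A i * u (q m * pderiv (P j)) + B i * u (q m * pderiv (P i)) +
          C i * u (q m * pderiv (prev P i))"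
        by (simp add: g_def j pderiv_add pderiv_smult algebra_simps u_simps)
      moreover have "u (q m * pderiv (prev P i)) = (if i = Suc m then - \<kappa> m else 0)"
        using less.IH[of "i - 1"] j by (auto simp: prev_def u_simps)
      moreover have "u (q m * pderiv (P i)) = (if i = m then - \<kappa> m else 0)"
        using less.IH[of i] j by simp
      ultimately have "A i * u (q m * pderiv (P j)) = u (q m * P i) - B i * (if i = m then - \<kappa> m else 0)
          - C i * (if i = Suc m then - \<kappa> m else 0)"
        by (simp add: algebra_simps split del: if_split)
      also have "\<dots> = A i * (if j = m then - \<kappa> m else 0)"
        unfolding u_q_P[OF that] by (auto simp: j)
      finally have "A i * u (q m * pderiv (P j)) = \<dots>" .
      then show ?thesis using A[OF \<open>i \<ge> k\<close>] by simp
    qed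
  qed
  show thesis
  proof
    fix m assume m: "m > k"
    show "x m \<noteq> 0" using A[of "m - 1"] m by (simp add: x_def)
    show "degree (q m) \<le> Suc m"
      by (auto simp: q_def intro!: degree_add_le order_trans[OF degree_smult_le])
    show "u (q m * f) = x m * coeff f (m - 1)" if "degree f \<le> m - 1" for f
      using m that by (rule u_q)
    show "fderiv (pmult (q m) u) = pmult (P m) u"
      by (rule pearson_if_basis) (simp add: u_simps u_dP[OF m] u_P_P)
  qed
qed

text \<open>By the product rule, the f for which D(f u) is a polynomial multiple of u form an ideal;
  division by an element of least degree shows that this element generates it.\<close>

lemma pearson_generator:
  assumes "q \<noteq> 0" "fderiv (pmult q u) = pmult g u"
  obtains \<phi> \<psi> where "\<phi> \<noteq> 0" "fderiv (pmult \<phi> u) = pmult \<psi> u"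
    "\<And>f g. fderiv (pmult f u) = pmult g u \<Longrightarrow> \<exists>h. f = \<phi> * h \<and> g = \<phi> * pderiv h + \<psi> * h"
proof -
  define R where "R f \<longleftrightarrow> f \<noteq> 0 \<and> (\<exists>g. fderiv (pmult f u) = pmult g u)" for f
  have "R q" using assms by (auto simp: R_def)
  then obtain \<phi> where "R \<phi>" and min: "\<And>f. R f \<Longrightarrow> degree \<phi> \<le> degree f"
    using ex_has_least_nat[of R q degree] by blast
  then obtain \<psi> where "\<phi> \<noteq> 0" and psi: "fderiv (pmult \<phi> u) = pmult \<psi> u"
    by (auto simp: R_def)
  have "\<exists>h. f = \<phi> * h \<and> g = \<phi> * pderiv h + \<psi> * h" if fg: "fderiv (pmult f u) = pmult g u" for f g
  proof -
    define h where "h = f div \<phi>"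
    \<comment> \<open>Subtracting the equation for \<open>\<phi> * h\<close> from that for f leaves
      one for the remainder, with right-hand side g'.\<close>
    define g' where "g' = g - (\<phi> * pderiv h + \<psi> * h)"
    have f: "f = \<phi> * h + f mod \<phi>" by (simp add: h_def)
    have D: "u ((f mod \<phi>) * pderiv p + g' * p) = 0" for p
    proof -
      have "(f mod \<phi>) * pderiv p + g' * p = (f * pderiv p + g * p) - (\<phi> * pderiv (h * p) + \<psi> * (h * p))"
        by (subst (2) f) (simp add: g'_def pderiv_mult algebra_simps)
      then show ?thesis
        using fg psi by (simp only: u_simps fderiv_pmult_eq_iff[OF functional]) simp
    qed
    then have D': "fderiv (pmult (f mod \<phi>) u) = pmult g' u"
      by (simp add: fderiv_pmult_eq_iff[OF functional])
    have "f mod \<phi> = 0"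
    proof (rule ccontr)
      assume "f mod \<phi> \<noteq> 0"
      then have "degree \<phi> \<le> degree (f mod \<phi>)" using min D' by (auto simp: R_def)
      moreover have "degree (f mod \<phi>) < degree \<phi>"
        using degree_mod_less[OF \<open>\<phi> \<noteq> 0\<close>, of f] \<open>f mod \<phi> \<noteq> 0\<close> by blast
      ultimately show False by simp
    qed
    moreover from this have "g' = 0" using D by (intro zero_if_orthogonal) simp
    ultimately show ?thesis using f by (auto simp: g'_def intro!: exI[of _ h])
  qed
  with \<open>\<phi> \<noteq> 0\<close> psi that show thesis by blast
qed

text \<open>Write \<open>q m = \<phi> * h m\<close> with the generator \<phi>. As \<open>q m\<close>
  has degree at most m + 1, a single m with \<open>h m\<close> of degree at least m - 1 bounds the
  degree of \<phi> by two.\<close>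

lemma C1_if_C4:
  assumes "C4_with P (Suc k) r s"
  shows "C1 u"
proof -
  obtain q x where x: "\<And>m. m > k \<Longrightarrow> x m \<noteq> 0" and degree_q: "\<And>m. m > k \<Longrightarrow> degree (q m) \<le> Suc m" and
    u_q: "\<And>m f. m > k \<Longrightarrow> degree f \<le> m - 1 \<Longrightarrow> u (q m * f) = x m * coeff f (m - 1)" and
    pearson_q: "\<And>m. m > k \<Longrightarrow> fderiv (pmult (q m) u) = pmult (P m) u"
    by (rule pearson_family_if_C4[OF assms]) (rule that; blast)
  have q_nonzero: "q m \<noteq> 0" if "m > k" for m
    using u_q[OF that, of "P (m - 1)"] x[OF that] by (auto simp: u_simps)
  have q_lower: "m - 1 \<le> degree (q m)" if "m > k" for m
  proof (rule ccontr)
    assume "\<not> m - 1 \<le> degree (q m)"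
    then have "u (q m * P (degree (q m))) = 0"
      using u_q[OF that, of "P (degree (q m))"] by (simp add: coeff_eq_0)
    moreover have "u (q m * P (degree (q m))) = lead_coeff (q m) * \<kappa> (degree (q m))"
      by (rule u_P_times) simp
    ultimately show False using q_nonzero[OF that] by simp
  qed
  obtain \<phi> \<psi> where phi: "\<phi> \<noteq> 0" and D: "fderiv (pmult \<phi> u) = pmult \<psi> u" and
    gen: "\<And>f g. fderiv (pmult f u) = pmult g u \<Longrightarrow> \<exists>h. f = \<phi> * h \<and> g = \<phi> * pderiv h + \<psi> * h"
    by (rule pearson_generator[OF q_nonzero[OF lessI] pearson_q[OF lessI]]) (rule that; blast)
  obtain h where h: "\<And>m. m > k \<Longrightarrow> q m = \<phi> * h m \<and> P m = \<phi> * pderiv (h m) + \<psi> * h m"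
    using gen[OF pearson_q] by metis
  have h_nonzero: "h m \<noteq> 0" if "m > k" for m
    using h[OF that] q_nonzero[OF that] by auto
  have degree_q_h: "degree (q m) = degree \<phi> + degree (h m)" if "m > k" for m
    using h[OF that] h_nonzero[OF that] phi by (simp add: degree_mult_eq)
  \<comment> \<open>Pairing \<open>h m\<close> with \<open>h (m + j)\<close> in both orders would otherwise keep all degrees bounded.\<close>
  have "\<exists>m>k. m \<le> degree (h m) + 1"
  proof (rule ccontr)
    assume "\<not> (\<exists>m>k. m \<le> degree (h m) + 1)"
    then have small: "degree (h m) + 2 \<le> m" if "m > k" for m
      using that by (metis add_2_eq_Suc' Suc_eq_plus1 not_less_eq_eq)
    have bounded: "degree (h (m + j)) + 2 \<le> m" if "m > k" for m j
      using that
    proof (induction j arbitrary: m)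
      case 0
      then show ?case using small by simp
    next
      case (Suc j)
      have deg: "degree (h (m + Suc j)) \<le> m - 1"
        using Suc.IH[of "Suc m"] Suc.prems by simp
      have "x m * coeff (h (m + Suc j)) (m - 1) = u (q m * h (m + Suc j))"
        using u_q[OF Suc.prems deg] by simp
      \<comment> \<open>Both arguments of u equal
        \<open>\<phi> * h m * h (m + Suc j)\<close>.\<close>
      also have "\<dots> = u (q (m + Suc j) * h m)"
        using h[of m] h[of "m + Suc j"] Suc.prems by (simp add: mult_ac)
      also have "\<dots> = x (m + Suc j) * coeff (h m) (m + Suc j - 1)"
        using small[OF Suc.prems] Suc.prems by (intro u_q) auto
      also have "coeff (h m) (m + Suc j - 1) = 0"
        using small[OF Suc.prems] by (intro coeff_eq_0) simp
      finally have "coeff (h (m + Suc j)) (m - 1) = 0" using x[OF Suc.prems] by simp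
      then have "degree (h (m + Suc j)) \<noteq> m - 1"
        using h_nonzero[of "m + Suc j"] Suc.prems by (metis leading_coeff_0_iff trans_less_add1)
      then show ?case using deg small[OF Suc.prems] by linarith
    qed
    \<comment> \<open>All later \<open>h\<close> would have degree below k, while the degree of
      \<open>q m\<close> is at least m - 1; the offset \<open>degree \<phi> + 1\<close> makes the
      two bounds collide.\<close>
    show False
      using bounded[of "Suc k" "degree \<phi> + 1"] q_lower[of "Suc k + (degree \<phi> + 1)"]
        degree_q_h[of "Suc k + (degree \<phi> + 1)"] by simp
  qed
  then obtain m where m: "m > k" "m \<le> degree (h m) + 1" by blast
  have deg_phi: "degree \<phi> \<le> 2"
    using degree_q[OF m(1)] degree_q_h[OF m(1)] m(2) by linarith
  \<comment> \<open>Otherwise \<open>\<psi> * h m\<close> would dominate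
    \<open>\<phi> * pderiv (h m)\<close>, and \<open>P m\<close> would have degree above m.\<close>
  have "degree \<psi> \<le> 1"
  proof (rule ccontr)
    assume psi: "\<not> degree \<psi> \<le> 1"
    then have prod: "degree (\<psi> * h m) = degree \<psi> + degree (h m)"
      using h_nonzero[OF m(1)] by (intro degree_mult_eq) auto
    have "degree (\<phi> * pderiv (h m)) < degree \<psi> + degree (h m)"
      using degree_quadratic_mult_pderiv[OF deg_phi, of 0 "h m" "degree (h m)"] psi by simp
    then have "degree (P m) = degree \<psi> + degree (h m)"
      using h[OF m(1)] prod by (simp add: degree_add_eq_right)
    then show False using psi m(2) by simp
  qed
  with C1_forI[OF deg_phi _ D] phi show ?thesis by (auto simp: C1_def)
qed

end

section \<open>The equivalences and the parameter formulas assembled\<close>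

theorem theorem3p1:
  fixes u :: functional and P :: "nat \<Rightarrow> complex poly"
  assumes "regular u" and "monic_OP_wrt u P"
  shows
    "(C1 u \<longleftrightarrow> C1' u) \<and> (C1 u \<longleftrightarrow> C2 P) \<and> (C1 u \<longleftrightarrow> C3 P) \<and> (C1 u \<longleftrightarrow> C3' P) \<and>
     (C1 u \<longleftrightarrow> C4 P) \<and> (C1 u \<longleftrightarrow> C4' P) \<and> (C1 u \<longleftrightarrow> C5 P) \<and> (C1 u \<longleftrightarrow> C6 u) \<and>
     (C1 u \<longleftrightarrow> C7 P) \<and> (C1 u \<longleftrightarrow> C8 u P) \<and>
     (\<exists>\<beta> \<gamma>. TTRR P \<beta> \<gamma> \<and>
       (\<forall>\<phi> \<psi>. C1_for u \<phi> \<psi> \<longrightarrow>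
         C1'_for u \<phi> \<psi> \<and>
         (\<exists>a b c. C2_with P \<phi> a b c) \<and>
         (\<exists>l. C5_with P \<phi> \<psi> l) \<and>
         C6_for u \<phi> \<psi> \<and>
         (\<exists>h t. C7_with P \<phi> \<psi> h t) \<and>
         (\<exists>k. C8_with u P \<phi> k) \<and>
         (let d = dcoef \<phi> \<psi> in
           (\<forall>n. \<beta> n = beta_formula \<phi> \<psi> n) \<and>
           (\<forall>n\<ge>1. \<gamma> n = gamma_formula \<phi> \<psi> n) \<and>
           (\<forall>a b c. C2_with P \<phi> a b c \<longrightarrow>
              (\<forall>n. a n = of_nat n * coeff \<phi> 2 \<and> b n = - (1 / 2) * poly \<psi> (\<beta> n)) \<and>
              (\<forall>n\<ge>1. c n = - d (int n - 1) * \<gamma> n)) \<and>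
           (\<forall>r s. C4_with P 1 r s \<longrightarrow>
              (\<forall>n\<ge>2. r n = poly \<psi> (\<beta> n) / (2 * d (int n - 1)) \<and>
                     s n = - ((of_nat n - 1) * coeff \<phi> 2 / d (int n - 2)) * \<gamma> n)) \<and>
           (\<forall>l. C5_with P \<phi> \<psi> l \<longrightarrow>
              (\<forall>n. l n = - of_nat n * d (int n - 1))) \<and>
           (\<forall>h t. C7_with P \<phi> \<psi> h t \<longrightarrow>
              (\<forall>n\<ge>1. h n = d (2 * int n - 3) \<and> t n = - d (2 * int n - 1) * \<gamma> n)) \<and>
           (\<forall>k. C8_with u P \<phi> k \<longrightarrow>
              (\<forall>n. k n = (\<Prod>i<n. inverse (d (int n + int i - 1))))))))"
proof -
  interpret monic_ops u P
    using assms by (intro monic_ops.intro) (simp_all add: regular_def)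
  have C1_C1': "C1 u \<longleftrightarrow> C1' u"
    by (simp add: C1_def C1'_def C1_for_iff_C1'_for)
  have C1_C6: "C1 u \<longleftrightarrow> C6 u"
    by (simp add: C1_def C6_def C6_for_iff_C1'_for[OF functional] C1_for_iff_C1'_for)
  have C4_C1: "C1 u" if "C4 P"
    using that C1_if_C4 by (auto simp: C4_def elim!: Suc_le_D[THEN exE])
  have C3_C4: "\<exists>r s. C4_with P k r s" if "monic_OP (nderiv P k)" "k \<ge> 1" for k
    using that C4_with_if_monic_OP by (metis One_nat_def Suc_le_D)
  have C1_C3': "C3' P" if "C1 u"
    using that monic_OP_nderiv classicalI unfolding C3'_def C1_def by blast
  have C1_rest: "C2 P \<and> C5 P \<and> C7 P \<and> C8 u P" if C1: "C1 u"
  proof -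
    from C1 obtain \<phi> \<psi> where "C1_for u \<phi> \<psi>" by (auto simp: C1_def)
    then interpret classical u P \<phi> \<psi> by (rule classicalI)
    show ?thesis
      using C2_with_structure C5_with_ode C7_with_classical C8_with_rodrigues
      unfolding C2_def C5_def C7_def C8_def by blast
  qed
  \<comment> \<open>Both (C3') to (C3) to (C4) and (C3') to (C4') to (C4) end in (C4), which closes
    the circle through (C1).\<close>
  have "C3' P \<Longrightarrow> C3 P" "C3' P \<Longrightarrow> C4' P" "C4' P \<Longrightarrow> C4 P" "C3 P \<Longrightarrow> C4 P"
    using C3_C4 by (auto simp: C3'_def C3_def C4'_def C4_def)
  with C1_C1' C1_C6 C4_C1 C1_C3' C1_rest C1_if_C2 C1_if_C5 C1_if_C7 C1_if_C8
  have equiv: "(C1 u \<longleftrightarrow> C1' u) \<and> (C1 u \<longleftrightarrow> C2 P) \<and> (C1 u \<longleftrightarrow> C3 P) \<and> (C1 u \<longleftrightarrow> C3' P) \<and>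
     (C1 u \<longleftrightarrow> C4 P) \<and> (C1 u \<longleftrightarrow> C4' P) \<and> (C1 u \<longleftrightarrow> C5 P) \<and> (C1 u \<longleftrightarrow> C6 u) \<and>
     (C1 u \<longleftrightarrow> C7 P) \<and> (C1 u \<longleftrightarrow> C8 u P)"
    by blast
  have params: "C1'_for u \<phi> \<psi> \<and>
         (\<exists>a b c. C2_with P \<phi> a b c) \<and>
         (\<exists>l. C5_with P \<phi> \<psi> l) \<and>
         C6_for u \<phi> \<psi> \<and>
         (\<exists>h t. C7_with P \<phi> \<psi> h t) \<and>
         (\<exists>k. C8_with u P \<phi> k) \<and>
         (let d = dcoef \<phi> \<psi> in
           (\<forall>n. \<beta> n = beta_formula \<phi> \<psi> n) \<and>
           (\<forall>n\<ge>1. \<gamma> n = gamma_formula \<phi> \<psi> n) \<and>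
           (\<forall>a b c. C2_with P \<phi> a b c \<longrightarrow>
              (\<forall>n. a n = of_nat n * coeff \<phi> 2 \<and> b n = - (1 / 2) * poly \<psi> (\<beta> n)) \<and>
              (\<forall>n\<ge>1. c n = - d (int n - 1) * \<gamma> n)) \<and>
           (\<forall>r s. C4_with P 1 r s \<longrightarrow>
              (\<forall>n\<ge>2. r n = poly \<psi> (\<beta> n) / (2 * d (int n - 1)) \<and>
                     s n = - ((of_nat n - 1) * coeff \<phi> 2 / d (int n - 2)) * \<gamma> n)) \<and>
           (\<forall>l. C5_with P \<phi> \<psi> l \<longrightarrow>
              (\<forall>n. l n = - of_nat n * d (int n - 1))) \<and>
           (\<forall>h t. C7_with P \<phi> \<psi> h t \<longrightarrow>
              (\<forall>n\<ge>1. h n = d (2 * int n - 3) \<and> t n = - d (2 * int n - 1) * \<gamma> n)) \<and>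
           (\<forall>k. C8_with u P \<phi> k \<longrightarrow>
              (\<forall>n. k n = (\<Prod>i<n. inverse (d (int n + int i - 1))))))"
    if C1_for: "C1_for u \<phi> \<psi>" for \<phi> \<psi>
  proof -
    interpret classical u P \<phi> \<psi> by (rule classicalI[OF C1_for])
    have "C1'_for u \<phi> \<psi>" "C6_for u \<phi> \<psi>"
      using C1_for by (simp_all add: C1_for_iff_C1'_for C6_for_iff_C1'_for[OF functional])
    \<comment> \<open>The formulas are claimed for arbitrary parameters satisfying the relations, so
      each existence result is matched with uniqueness.\<close>
    moreover have "a n = of_nat n * coeff \<phi> 2" "b n = - (1 / 2) * poly \<psi> (\<beta> n)"
      "n \<ge> 1 \<Longrightarrow> c n = - d (int n - 1) * \<gamma> n" if "C2_with P \<phi> a b c" for a b c n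
      using C2_with_unique[OF that C2_with_structure] by blast+
    moreover have "r n = poly \<psi> (\<beta> n) / (2 * d (int n - 1))"
      "s n = - ((of_nat n - 1) * coeff \<phi> 2 / d (int n - 2)) * \<gamma> n"
      if "C4_with P 1 r s" "n \<ge> 2" for r s n
      using monic_graded.monic_expansion_unique[OF monic_graded_nderiv that(2)] that C4_with_1
      unfolding C4_with_def by metis+
    ultimately show ?thesis
      unfolding Let_def
      using C2_with_structure C5_with_ode C7_with_classical C8_with_rodrigues beta_eq gamma_eq
        C5_with_unique C7_with_unique C8_with_unique by (intro conjI allI impI) blast+
  qed
  show ?thesis
    using equiv TTRR_P params by blast
qed

end
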